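(* Let $c\in\mathbb{C}$ and let $n\geq 1$ be an integer. Let $f(z)$ be a nonconstant entire function of finite order such that $\Delta_c^n f(z)\not\equiv 0$ and such that $f(z)$, $\Delta_c^n f(z)$ and $\Delta_c^{n+1} f(z)$ share $0$ CM. If there exist a point $z_0\in\mathbb{C}$ and an integer $m\geq 1$ such that $\Delta_c^m f(z_0)=f(z_0)\neq 0$, then $\Delta_c^m f(z)\equiv f(z)$ (for this $m$).
   Context: Difference operators: for a meromorphic function $f$ in $\mathbb{C}$, $\Delta_c f(z)=f(z+c)-f(z)$ and $\Delta_c^n f(z)=\Delta_c^{n-1}(\Delta_c f(z))$ for $n\geq 2$. Finite order means $\rho(f)=\limsup_{r\to\infty}\frac{\log^+ T(r,f)}{\log r}<\infty$, where $T(r,f)$ is the Nevanlinna characteristic. Functions share $0$ CM if they all have the same zeros, counting multiplicities. *)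

theory Defs
  imports "HOL-Complex_Analysis.Complex_Analysis"
begin

definition fdiff :: "complex \<Rightarrow> (complex \<Rightarrow> complex) \<Rightarrow> complex \<Rightarrow> complex" where
  "fdiff c f = (\<lambda>z. f (z + c) - f z)"

abbreviation fdiff_pow :: "complex \<Rightarrow> nat \<Rightarrow> (complex \<Rightarrow> complex) \<Rightarrow> complex \<Rightarrow> complex" where
  "fdiff_pow c n f \<equiv> (fdiff c ^^ n) f"

lemma fdiff_pow_Suc: "fdiff_pow c (Suc n) f = fdiff_pow c n (fdiff c f)"
  by (simp add: funpow_swap1)

definition ln_plus :: "real \<Rightarrow> real" where
  "ln_plus x = ln (max 1 x)"

definition proximity_fun :: "(complex \<Rightarrow> complex) \<Rightarrow> real \<Rightarrow> real" where
  "proximity_fun f r =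
     1 / (2 * pi) * integral {0..2*pi} (\<lambda>t. ln_plus (norm (f (of_real r * cis t))))"

text \<open>The number of poles in the closed disc of radius \<open>r\<close> about the origin, with multiplicity;
  at a pole, \<open>zorder\<close> is minus the multiplicity.\<close>

definition pole_count :: "(complex \<Rightarrow> complex) \<Rightarrow> real \<Rightarrow> real" where
  "pole_count f r = (\<Sum>z | z \<in> cball 0 r \<and> is_pole f z. - of_int (zorder f z))"

definition pole_counting_fun :: "(complex \<Rightarrow> complex) \<Rightarrow> real \<Rightarrow> real" where
  "pole_counting_fun f r =
     integral {0..r} (\<lambda>t. (pole_count f t - pole_count f 0) / t) + pole_count f 0 * ln r"

definition nevanlinna_char :: "(complex \<Rightarrow> complex) \<Rightarrow> real \<Rightarrow> real" where
  "nevanlinna_char f r = proximity_fun f r + pole_counting_fun f r"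

definition growth_order :: "(complex \<Rightarrow> complex) \<Rightarrow> ereal" where
  "growth_order f = Limsup at_top (\<lambda>r. ereal (ln_plus (nevanlinna_char f r) / ln r))"

text \<open>Meant for entire functions. The value of \<open>zorder\<close> is meaningless for the zero function,
  but this is harmless: equality of the zero sets forces either all members of \<open>F\<close> or none of them
  to vanish identically, and in the latter case all zeros are isolated and \<open>zorder\<close> is the
  multiplicity.\<close>

definition share_zero_CM :: "(complex \<Rightarrow> complex) set \<Rightarrow> bool" where
  "share_zero_CM F \<longleftrightarrow>
     (\<forall>f\<in>F. \<forall>g\<in>F. {z. f z = 0} = {z. g z = 0} \<and> (\<forall>z. f z = 0 \<longrightarrow> zorder f z = zorder g z))"

end

theory Submission
  imports Defs
begin

text \<open>
  Put \<open>F = \<Delta>\<^sup>n f\<close>. Since \<open>f\<close> has finite order and the zeros are shared, \<open>F = exp(P) f\<close> and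
  \<open>\<Delta> F = exp(R) F\<close> with polynomials \<open>P\<close> and \<open>R\<close>, so \<open>F(z + c) = (1 + exp R(z)) F(z)\<close>. Expanding
  \<open>\<Delta>\<^sup>n (exp(-P) F) = F\<close> and dividing by \<open>F\<close> leaves an identity between exponentials of polynomials,
  and its growth along rays leaves only two possibilities. Either \<open>P\<close> and \<open>R\<close> are constant, so that
  \<open>f(z + c) = A f(z)\<close> and \<open>\<Delta>\<^sup>m f = (A - 1)\<^sup>m f\<close>, and the value at \<open>z\<^sub>0\<close> gives \<open>(A - 1)\<^sup>m = 1\<close>. Or \<open>R\<close> is
  linear and \<open>F(z + nc) = H(z) F(z)\<close> with \<open>H\<close> periodic under \<open>nc\<close>; then \<open>F = H\<^sup>N F(\<cdot> - Nnc)\<close> for every \<open>N\<close>,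
  and \<open>F\<close> vanishes to infinite order at a zero of \<open>H\<close>, which is absurd.

  That \<open>P\<close> and \<open>R\<close> are polynomials follows without Hadamard factorisation: removing the zeros in a
  disc by Blaschke factors leaves a zero-free function with the same modulus on the circle, to
  whose log-modulus the Poisson formula applies.
\<close>

section \<open>Blaschke factors and the Poisson formula\<close>

lemma entire_zero_factor:
  assumes f: "f holomorphic_on UNIV" and nz: "f w \<noteq> 0"
  obtains h where "h holomorphic_on UNIV" "h a \<noteq> 0" "\<And>z. f z = (z - a) ^ nat (zorder f a) * h z"
proof -
  define g where "g = zor_poly f a"
  define k where "k = nat (zorder f a)"
  obtain r where r: "r > 0" "g holomorphic_on cball a r"
      "\<And>z. z \<in> cball a r \<Longrightarrow> f z = g z * (z - a) ^ k" "\<And>z. z \<in> cball a r \<Longrightarrow> g z \<noteq> 0"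
    using zorder_exist_zero[of f UNIV a] f nz unfolding g_def k_def by blast
  \<comment> \<open>\<open>zorder_exist_zero\<close> factors \<open>f\<close> only near
    \<open>a\<close>. The quotient by \<open>(z - a) ^ k\<close> is entire once its removable
    singularity is filled with the local value \<open>g a\<close>.\<close>
  define h where "h z = (if z = a then g a else f z / (z - a) ^ k)" for z
  have "isCont g a"
    using continuous_on_interior[OF holomorphic_on_imp_continuous_on[OF r(2)], of a] r(1)
    by (simp add: interior_cball)
  then have "g \<midarrow>a\<rightarrow> g a"
    by (simp add: isContD)
  moreover have "eventually (\<lambda>z. g z = f z / (z - a) ^ k) (at a)"
    using eventually_at_ball[OF r(1), of a UNIV] unfolding eventually_at_filter
    by eventually_elim (auto simp: r(3))
  ultimately have "(\<lambda>z. f z / (z - a) ^ k) \<midarrow>a\<rightarrow> g a"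
    by (rule Lim_transform_eventually)
  then have "(\<lambda>y. if y = a then g a else f y / (y - a) ^ k) holomorphic_on UNIV"
    by (intro removable_singularity) (auto intro!: holomorphic_intros holomorphic_on_subset[OF f])
  then have "h holomorphic_on UNIV"
    by (simp add: h_def[abs_def])
  moreover have "f z = (z - a) ^ k * h z" for z
    using r(1) r(3)[of a] by (auto simp: h_def)
  ultimately show ?thesis
    using that r(1) r(4)[of a] by (auto simp: h_def k_def)
qed

lemma entire_finite_zeros_cball:
  assumes "f holomorphic_on UNIV" "f w \<noteq> 0"
  shows "finite {z \<in> cball a R. f z = 0}"
proof (cases "f constant_on UNIV")
  case True
  then have "f z \<noteq> 0" for z
    using assms(2) by (auto simp: constant_on_def)
  then show ?thesis by simp
next
  case False
  then show ?thesis
    using holomorphic_compact_finite_zeros[OF assms(1), of "cball a R"] by (simp add: connected_UNIV)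
qed

text \<open>The last product vanishes on the circle of radius \<open>R\<close> and is nonnegative
  when both \<open>z\<close> and \<open>a\<close> lie in the disc. This compares the two parts of a
  Blaschke factor.\<close>

lemma norm_blaschke_numerator:
  fixes a z :: complex
  shows "(norm (of_real (R\<^sup>2) - cnj a * z))\<^sup>2 = (R * norm (z - a))\<^sup>2 + (R\<^sup>2 - (norm z)\<^sup>2) * (R\<^sup>2 - (norm a)\<^sup>2)"
  unfolding power_mult_distrib cmod_power2 by (simp add: power2_eq_square algebra_simps)

text \<open>A zero \<open>a\<close> of order \<open>k\<close> is removed by replacing
  \<open>(z - a) ^ k\<close> with the \<open>k\<close>-th power of
  \<open>(R^2 - cnj a * z) / R\<close>. That keeps the modulus on the circle, does not lower it
  inside, and creates no zero in the disc, so induction on the number of distinct zeros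
  applies.\<close>

lemma blaschke_reduction:
  assumes "f holomorphic_on UNIV" "f w \<noteq> 0" "R > 0" "\<And>z. norm z = R \<Longrightarrow> f z \<noteq> 0"
  shows "\<exists>v. v holomorphic_on UNIV \<and> (\<forall>z. norm z \<le> R \<longrightarrow> v z \<noteq> 0 \<and> norm (f z) \<le> norm (v z)) \<and>
    (\<forall>z. norm z = R \<longrightarrow> norm (v z) = norm (f z))"
  using assms
proof (induction "card {z \<in> cball 0 R. f z = 0}" arbitrary: f w rule: less_induct)
  case (less f)
  show ?case
  proof (cases "\<exists>a. norm a \<le> R \<and> f a = 0")
    case False
    then show ?thesis
      using less.prems(1) by (intro exI[of _ f]) auto
  next
    case True
    then obtain a where a: "norm a \<le> R" "f a = 0" by blast
    with less.prems(4) have aR: "norm a < R"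
      by (metis less_le)
    obtain h where h: "h holomorphic_on UNIV" "h a \<noteq> 0" "\<And>z. f z = (z - a) ^ nat (zorder f a) * h z"
      using entire_zero_factor[OF less.prems(1,2), of a] by blast
    define k where "k = nat (zorder f a)"
    have f_eq: "f z = (z - a) ^ k * h z" for z
      unfolding k_def by (rule h(3))
    \<comment> \<open>\<open>(z - a) / b z\<close> is the Blaschke factor of the disc of radius
      \<open>R\<close> with zero \<open>a\<close>.\<close>
    define b where "b z = (of_real (R\<^sup>2) - cnj a * z) / of_real R" for z :: complex
    define f1 where "f1 z = b z ^ k * h z" for z
    have b_sq: "(norm (b z))\<^sup>2 = (norm (z - a))\<^sup>2 + (R\<^sup>2 - (norm z)\<^sup>2) * (R\<^sup>2 - (norm a)\<^sup>2) / R\<^sup>2" for z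
      using less.prems(3) unfolding b_def norm_divide power_divide norm_blaschke_numerator
      by (simp add: power_mult_distrib add_divide_distrib)
    have a_sq: "R\<^sup>2 - (norm a)\<^sup>2 > 0"
      using aR by (simp add: power_strict_mono)
    have b_eq: "norm (b z) = norm (z - a)" if "norm z = R" for z
      using b_sq[of z] that by (simp add: power2_eq_iff_nonneg)
    have b_ge: "norm (z - a) \<le> norm (b z)" if "norm z \<le> R" for z
    proof -
      have "(norm z)\<^sup>2 \<le> R\<^sup>2"
        using that by (simp add: power_mono)
      then have "(norm (z - a))\<^sup>2 \<le> (norm (b z))\<^sup>2"
        using a_sq by (simp add: b_sq)
      then show ?thesis
        by (rule power2_le_imp_le) simp
    qed
    \<comment> \<open>At \<open>z = a\<close> the comparison with \<open>norm (z - a)\<close> is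
      void. There the exact value \<open>(R^2 - |a|^2)^2 / R^2\<close> of the squared modulus is
      positive because \<open>a\<close> is off the circle.\<close>
    have b_nz: "b z \<noteq> 0" if "norm z \<le> R" for z
    proof (cases "z = a")
      case True
      have "(norm (b a))\<^sup>2 > 0"
      proof -
        have "0 < (R\<^sup>2 - (norm a)\<^sup>2) * (R\<^sup>2 - (norm a)\<^sup>2) / R\<^sup>2"
          using a_sq less.prems(3) by (intro divide_pos_pos mult_pos_pos zero_less_power)
        then show ?thesis by (simp only: b_sq[of a] diff_self norm_zero power_zero_numeral add_0)
      qed
      then show ?thesis unfolding True zero_less_power2 norm_eq_zero .
    next
      case False
      then have "0 < norm (z - a)" by simp
      also have "\<dots> \<le> norm (b z)" by (rule b_ge[OF that])
      finally show ?thesis by simp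
    qed
    have hol1: "f1 holomorphic_on UNIV"
    proof -
      have "b holomorphic_on UNIV"
        unfolding b_def[abs_def] using less.prems(3) by (auto intro!: holomorphic_intros)
      then show ?thesis
        unfolding f1_def[abs_def] by (intro holomorphic_on_mult holomorphic_on_power h(1))
    qed
    have le1: "norm (f z) \<le> norm (f1 z)" if "norm z \<le> R" for z
      unfolding f_eq f1_def norm_mult norm_power
      by (intro mult_right_mono power_mono b_ge[OF that] norm_ge_zero)
    have eq1: "norm (f1 z) = norm (f z)" if "norm z = R" for z
      unfolding f_eq f1_def norm_mult norm_power b_eq[OF that] ..
    have nz1: "f1 a \<noteq> 0"
      using h(2) b_nz[of a] a by (simp add: f1_def)
    have "{z \<in> cball 0 R. f1 z = 0} \<subset> {z \<in> cball 0 R. f z = 0}"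
    proof
      show "{z \<in> cball 0 R. f1 z = 0} \<subseteq> {z \<in> cball 0 R. f z = 0}"
      proof safe
        fix z assume "z \<in> cball 0 R" "f1 z = 0"
        then show "f z = 0" using le1[of z] by simp
      qed
      show "{z \<in> cball 0 R. f1 z = 0} \<noteq> {z \<in> cball 0 R. f z = 0}"
      proof
        assume "{z \<in> cball 0 R. f1 z = 0} = {z \<in> cball 0 R. f z = 0}"
        moreover have "a \<in> {z \<in> cball 0 R. f z = 0}" using a by simp
        ultimately have "a \<in> {z \<in> cball 0 R. f1 z = 0}" by simp
        with nz1 show False by simp
      qed
    qed
    then have "card {z \<in> cball 0 R. f1 z = 0} < card {z \<in> cball 0 R. f z = 0}"
      using entire_finite_zeros_cball[OF less.prems(1,2)] by (rule psubset_card_mono[rotated])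
    moreover have "f1 z \<noteq> 0" if "norm z = R" for z
      using eq1[OF that] less.prems(4)[OF that] by force
    ultimately obtain v where v: "v holomorphic_on UNIV"
      "\<And>z. norm z \<le> R \<Longrightarrow> v z \<noteq> 0 \<and> norm (f1 z) \<le> norm (v z)"
      "\<And>z. norm z = R \<Longrightarrow> norm (v z) = norm (f1 z)"
      using less.hyps[of f1 a] hol1 nz1 less.prems(3) by blast
    have "norm (f z) \<le> norm (v z)" if "norm z \<le> R" for z
      using le1[OF that] v(2)[OF that] by linarith
    moreover have "norm (v z) = norm (f z)" if "norm z = R" for z
      using eq1[OF that] v(3)[OF that] by linarith
    ultimately show ?thesis
      using v(1,2) by blast
  qed
qed

section \<open>The Poisson formula and bounds at half the radius\<close>

lemma poisson_log_norm:
  assumes v: "v holomorphic_on UNIV" and nz: "\<And>z. norm z \<le> R \<Longrightarrow> v z \<noteq> 0" and w: "norm w < R"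
  shows "((\<lambda>t. ln (norm (v (of_real R * cis t))) * ((R\<^sup>2 - (norm w)\<^sup>2) / (norm (of_real R * cis t - w))\<^sup>2))
           has_integral 2 * pi * ln (norm (v w))) {0..2*pi}"
proof -
  have R: "R > 0" using w norm_ge_zero[of w] by linarith
  \<comment> \<open>By compactness \<open>v\<close> stays zero free on a slightly larger open disc,
    where it has a holomorphic logarithm \<open>V\<close>. Then \<open>ln (norm v)\<close> is the
    real part of \<open>V\<close> up to the circle.\<close>
  have "open {z. v z \<noteq> 0}"
    using holomorphic_on_imp_continuous_on[OF v]
    by (intro open_Collect_neq) auto
  moreover have "compact (cball (0::complex) R)" "cball 0 R \<subseteq> {z. v z \<noteq> 0}"
    using nz by auto
  ultimately obtain e where e: "e > 0" "(\<Union>x\<in>cball 0 R. ball x e) \<subseteq> {z. v z \<noteq> 0}"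
    using compact_subset_open_imp_ball_epsilon_subset by metis
  have nz': "v z \<noteq> 0" if "z \<in> ball 0 (R + e)" for z
  proof (cases "norm z \<le> R")
    case False
    \<comment> \<open>The radial projection of \<open>z\<close> to the circle, at distance
      \<open>norm z - R < e\<close> from \<open>z\<close>.\<close>
    define x where "x = of_real (R / norm z) * z"
    have "z \<noteq> 0"
    proof
      assume "z = 0"
      with False R show False by simp
    qed
    then have "norm x = R" using R by (simp add: x_def norm_mult norm_divide)
    moreover have "dist x z = norm z - R"
    proof -
      have "x - z = of_real (R / norm z - 1) * z" by (simp add: x_def algebra_simps)
      then have "norm (x - z) = \<bar>R / norm z - 1\<bar> * norm z"
        by (simp only: norm_mult norm_of_real)
      also have "\<dots> = norm z - R"
        using False R \<open>z \<noteq> 0\<close> by (simp add: field_simps abs_if)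
      finally show ?thesis by (simp add: dist_norm)
    qed
    ultimately show ?thesis
      using e(2) that by (force simp: subset_iff)
  qed (use nz in auto)
  have "\<exists>V. V holomorphic_on ball 0 (R + e) \<and> (\<forall>z\<in>ball 0 (R + e). v z = exp (V z))"
    using holomorphic_logarithm_exists[of "ball 0 (R + e)" v 0] nz' holomorphic_on_subset[OF v] R e(1)
    by (metis UNIV_I centre_in_ball convex_ball open_ball subsetI add_pos_pos)
  then obtain V where V: "V holomorphic_on ball 0 (R + e)" "\<And>z. z \<in> ball 0 (R + e) \<Longrightarrow> v z = exp (V z)"
    by blast
  \<comment> \<open>The factor beside \<open>V\<close> equals 1 at \<open>w\<close>, so Cauchy's
    formula for \<open>\<phi>\<close> returns \<open>V w\<close>. On the circle
    \<open>R^2 = z * cnj z\<close>, and the same factor times \<open>z / (z - w)\<close> is the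
    Poisson kernel.\<close>
  define \<phi> where "\<phi> z = V z * of_real (R\<^sup>2 - (norm w)\<^sup>2) / (of_real (R\<^sup>2) - cnj w * z)" for z
  have den: "of_real (R\<^sup>2) - cnj w * z \<noteq> 0" if "norm z \<le> R" for z
  proof
    assume "of_real (R\<^sup>2) - cnj w * z = 0"
    then have "R\<^sup>2 = norm (cnj w * z)"
      by (metis right_minus_eq norm_of_real abs_power2)
    also have "\<dots> \<le> norm w * R"
      using that by (simp add: norm_mult mult_left_mono)
    also have "\<dots> < R\<^sup>2"
      using w R by (simp add: power2_eq_square)
    finally show False by simp
  qed
  have "\<phi> holomorphic_on cball 0 R"
    unfolding \<phi>_def using den e(1)
    by (intro holomorphic_intros holomorphic_on_subset[OF V(1)]) auto
  then have "((\<lambda>u. \<phi> u / (u - w)) has_contour_integral (2 * of_real pi * \<i> * \<phi> w)) (circlepath 0 R)"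
    using w by (intro Cauchy_integral_circlepath)
      (auto intro: holomorphic_on_imp_continuous_on holomorphic_on_subset)
  then have "((\<lambda>t. \<phi> (0 + R * cis t) / ((0 + R * cis t) - w) * R * \<i> * cis t) has_integral (2 * of_real pi * \<i> * \<phi> w)) {0..2*pi}"
    unfolding circlepath_def by (subst (asm) has_contour_integral_part_circlepath_iff) auto
  \<comment> \<open>Multiplying by \<open>-\<i>\<close> cancels the \<open>\<i>\<close> from the
    derivative of the circle path, so that the kernel becomes real and taking real parts leaves
    \<open>Re V\<close>.\<close>
  then have "((\<lambda>t. - \<i> * (\<phi> (0 + R * cis t) / ((0 + R * cis t) - w) * R * \<i> * cis t))
      has_integral - \<i> * (2 * of_real pi * \<i> * \<phi> w)) {0..2*pi}"
    by (rule has_integral_mult_right)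
  then have "((\<lambda>t. Re (- \<i> * (\<phi> (0 + R * cis t) / ((0 + R * cis t) - w) * R * \<i> * cis t)))
      has_integral Re (- \<i> * (2 * of_real pi * \<i> * \<phi> w))) {0..2*pi}"
    by (rule has_integral_Re)
  moreover have "Re (- \<i> * (2 * of_real pi * \<i> * \<phi> w)) = 2 * pi * ln (norm (v w))"
  proof -
    have "complex_of_real (R\<^sup>2 - (norm w)\<^sup>2) = of_real (R\<^sup>2) - cnj w * w"
      by (simp only: of_real_diff complex_norm_square mult.commute)
    then have "\<phi> w = V w"
      using den[of w] w by (simp add: \<phi>_def)
    then show ?thesis
      using V(2)[of w] w e(1) by simp
  qed
  moreover have "Re (- \<i> * (\<phi> (0 + R * cis t) / ((0 + R * cis t) - w) * R * \<i> * cis t)) =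
      ln (norm (v (of_real R * cis t))) * ((R\<^sup>2 - (norm w)\<^sup>2) / (norm (of_real R * cis t - w))\<^sup>2)" for t
  proof -
    define z where "z = of_real R * cis t"
    have nz: "norm z = R" using R by (simp add: z_def norm_mult)
    have zw: "z \<noteq> w" using nz w by auto
    have zz: "complex_of_real (R\<^sup>2) = z * cnj z"
      using nz by (metis complex_norm_square of_real_power)
    have "z \<noteq> 0" using nz R by auto
    have "- \<i> * (\<phi> z / (z - w) * R * \<i> * cis t) = \<phi> z / (z - w) * z"
      by (simp add: z_def algebra_simps)
    also have "\<dots> = V z * of_real (R\<^sup>2 - (norm w)\<^sup>2) / ((z * (cnj z - cnj w)) * (z - w)) * z"
      unfolding \<phi>_def zz by (simp add: algebra_simps)
    also have "\<dots> = V z * of_real (R\<^sup>2 - (norm w)\<^sup>2) / ((z - w) * cnj (z - w))"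
    proof -
      have "x / ((z * y) * u) * z = x / (u * y)" for x y u
        using \<open>z \<noteq> 0\<close> by (simp add: mult_ac)
      then show ?thesis
        by (simp only: complex_cnj_diff)
    qed
    also have "\<dots> = of_real ((R\<^sup>2 - (norm w)\<^sup>2) / (norm (z - w))\<^sup>2) * V z"
      unfolding complex_norm_square[symmetric] by simp
    finally have "Re (- \<i> * (\<phi> z / (z - w) * R * \<i> * cis t)) = ((R\<^sup>2 - (norm w)\<^sup>2) / (norm (z - w))\<^sup>2) * Re (V z)"
      by simp
    moreover have "Re (V z) = ln (norm (v z))"
      using V(2)[of z] nz e(1) by simp
    ultimately show ?thesis
      by (simp add: z_def)
  qed
  ultimately show ?thesis
    by simp
qed

text \<open>The kernel is at most \<open>(R + |w|) / (R - |w|)\<close>, and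
  \<open>|w| \<le> R / 2\<close> gives \<open>R + |w| \<le> 3 * (R - |w|)\<close>.\<close>

lemma poisson_kernel_bounds:
  assumes "norm z = R" "norm w \<le> R / 2" "R > 0"
  shows "0 \<le> (R\<^sup>2 - (norm w)\<^sup>2) / (norm (z - w))\<^sup>2" "(R\<^sup>2 - (norm w)\<^sup>2) / (norm (z - w))\<^sup>2 \<le> 3"
proof -
  have "R\<^sup>2 - (norm w)\<^sup>2 = (R - norm w) * (R + norm w)"
    by (simp add: power2_eq_square algebra_simps)
  also have "\<dots> \<le> (R - norm w) * (3 * (R - norm w))"
    using assms by (intro mult_left_mono) auto
  finally have 1: "R\<^sup>2 - (norm w)\<^sup>2 \<le> 3 * (R - norm w)\<^sup>2"
    by (simp only: power2_eq_square mult.left_commute)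
  have "R - norm w \<le> norm (z - w)"
    using norm_triangle_ineq2[of z w] assms by simp
  then have 2: "(R - norm w)\<^sup>2 \<le> (norm (z - w))\<^sup>2" "(R - norm w)\<^sup>2 > 0"
    using assms by (auto intro!: power_mono)
  show "0 \<le> (R\<^sup>2 - (norm w)\<^sup>2) / (norm (z - w))\<^sup>2"
    using assms by (intro divide_nonneg_nonneg) (auto intro!: power_mono)
  show "(R\<^sup>2 - (norm w)\<^sup>2) / (norm (z - w))\<^sup>2 \<le> 3"
    using 1 2 by (subst pos_divide_le_eq) linarith+
qed

text \<open>The classical passage from the characteristic to the maximum modulus. The Poisson
  formula is applied to the zero-free majorant \<open>v\<close> of \<open>f\<close>; on the circle
  \<open>ln (norm v)\<close> is at most \<open>ln_plus (norm f)\<close>, and the kernel is at most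
  3.\<close>

lemma norm_le_exp_proximity_fun:
  assumes f: "f holomorphic_on UNIV" "f a \<noteq> 0" and R: "R > 0" "\<And>z. norm z = R \<Longrightarrow> f z \<noteq> 0"
    and w: "norm w \<le> R / 2"
  shows "norm (f w) \<le> exp (3 * proximity_fun f R)"
proof -
  obtain v where v: "v holomorphic_on UNIV"
    "\<And>z. norm z \<le> R \<Longrightarrow> v z \<noteq> 0" "\<And>z. norm z \<le> R \<Longrightarrow> norm (f z) \<le> norm (v z)"
    "\<And>z. norm z = R \<Longrightarrow> norm (v z) = norm (f z)"
    using blaschke_reduction[OF f R] by auto
  have wR: "norm w < R" using w R(1) by linarith
  have "continuous_on {0..2*pi} (\<lambda>t. ln_plus (norm (f (of_real R * cis t))))"
    unfolding ln_plus_def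
    by (intro continuous_intros continuous_on_compose2[OF holomorphic_on_imp_continuous_on[OF f(1)]])
      auto
  then have "((\<lambda>t. ln_plus (norm (f (of_real R * cis t)))) has_integral 
      integral {0..2*pi} (\<lambda>t. ln_plus (norm (f (of_real R * cis t))))) {0..2*pi}"
    by (intro integrable_integral integrable_continuous_real)
  then have "((\<lambda>t. ln_plus (norm (f (of_real R * cis t)))) has_integral 2 * pi * proximity_fun f R) {0..2*pi}"
    by (simp add: proximity_fun_def)
  then have "((\<lambda>t. ln_plus (norm (f (of_real R * cis t))) * 3) has_integral 2 * pi * proximity_fun f R * 3) {0..2*pi}"
    by (rule has_integral_mult_left)
  with poisson_log_norm[OF v(1,2) wR] 
  have "2 * pi * ln (norm (v w)) \<le> 2 * pi * proximity_fun f R * 3"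
  proof (rule has_integral_le)
    fix t :: real
    define z where "z = of_real R * cis t"
    have z: "norm z = R" using R(1) by (simp add: z_def norm_mult)
    note K = poisson_kernel_bounds[OF z w R(1)]
    have "ln (norm (v z)) \<le> ln_plus (norm (f z))"
      using v(2)[of z] v(4)[of z] z unfolding ln_plus_def by (subst ln_le_cancel_iff) auto
    then have "ln (norm (v z)) * ((R\<^sup>2 - (norm w)\<^sup>2) / (norm (z - w))\<^sup>2)
        \<le> ln_plus (norm (f z)) * ((R\<^sup>2 - (norm w)\<^sup>2) / (norm (z - w))\<^sup>2)"
      using K(1) by (rule mult_right_mono)
    also have "\<dots> \<le> ln_plus (norm (f z)) * 3"
      using K(2) by (rule mult_left_mono) (simp add: ln_plus_def)
    finally show "ln (norm (v (of_real R * cis t))) * ((R\<^sup>2 - (norm w)\<^sup>2) / (norm (of_real R * cis t - w))\<^sup>2)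
        \<le> ln_plus (norm (f (of_real R * cis t))) * 3"
      by (simp add: z_def)
  qed
  then have "ln (norm (v w)) \<le> 3 * proximity_fun f R"
    by simp
  moreover have "norm (v w) > 0" using v(2)[of w] wR by simp
  ultimately have "norm (v w) \<le> exp (3 * proximity_fun f R)"
    by (metis exp_le_cancel_iff exp_ln)
  with v(3)[of w] wR show ?thesis by simp
qed

text \<open>Harnack's inequality for the nonnegative harmonic function
  \<open>ln (M / norm v)\<close>: its value at \<open>w\<close> is at most 3 times its value at
  0.\<close>

lemma harnack_lower_bound:
  assumes v: "v holomorphic_on UNIV" "\<And>z. norm z \<le> R \<Longrightarrow> v z \<noteq> 0"
    and M: "\<And>z. norm z = R \<Longrightarrow> norm (v z) \<le> M" "M > 0" and w: "norm w \<le> R / 2" and R: "R > 0"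
  shows "norm (v 0) ^ 3 \<le> M ^ 2 * norm (v w)"
proof -
  have wR: "norm w < R" using w R by linarith
  define v1 where "v1 z = v z / of_real M" for z
  have v1: "v1 holomorphic_on UNIV" "\<And>z. norm z \<le> R \<Longrightarrow> v1 z \<noteq> 0"
    unfolding v1_def using v M(2) by (auto intro!: holomorphic_intros)
  have le: "norm (v1 z) \<le> 1" if "norm z = R" for z
    using M that by (simp add: v1_def norm_divide)
  have "((\<lambda>t. ln (norm (v1 (of_real R * cis t))) * ((R\<^sup>2 - (norm (0::complex))\<^sup>2) / (norm (of_real R * cis t - 0))\<^sup>2) * 3)
           has_integral 2 * pi * ln (norm (v1 0)) * 3) {0..2*pi}"
    by (rule has_integral_mult_left, rule poisson_log_norm[OF v1]) (use R in auto)
  then have "2 * pi * ln (norm (v1 0)) * 3 \<le> 2 * pi * ln (norm (v1 w))"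
  proof (rule has_integral_le[OF _ poisson_log_norm[OF v1 wR]])
    fix t :: real
    define z where "z = of_real R * cis t"
    have z: "norm z = R" using R by (simp add: z_def norm_mult)
    note K = poisson_kernel_bounds[OF z w R]
    have "ln (norm (v1 z)) \<le> 0"
      using le[of z] v1(2)[of z] z by simp
    then have "ln (norm (v1 z)) * 3 \<le> ln (norm (v1 z)) * ((R\<^sup>2 - (norm w)\<^sup>2) / (norm (z - w))\<^sup>2)"
      using K(2) by (rule mult_left_mono_neg[rotated])
    moreover have "(R\<^sup>2 - (norm (0::complex))\<^sup>2) / (norm (z - 0))\<^sup>2 = 1"
      using z R by simp
    ultimately show "ln (norm (v1 (of_real R * cis t))) * ((R\<^sup>2 - (norm (0::complex))\<^sup>2) / (norm (of_real R * cis t - 0))\<^sup>2) * 3 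
      \<le> ln (norm (v1 (of_real R * cis t))) * ((R\<^sup>2 - (norm w)\<^sup>2) / (norm (of_real R * cis t - w))\<^sup>2)"
      unfolding z_def by simp
  qed
  then have "3 * ln (norm (v1 0)) \<le> ln (norm (v1 w))"
    by simp
  moreover have pos: "norm (v1 0) > 0" "norm (v1 w) > 0" using v1(2)[of w] v1(2)[of 0] wR R by auto
  ultimately have "ln (norm (v1 0) ^ 3) \<le> ln (norm (v1 w))"
    by (simp add: ln_realpow)
  then have "norm (v1 0) ^ 3 \<le> norm (v1 w)"
    using pos by (subst (asm) ln_le_cancel_iff) auto
  then show ?thesis
    using M(2) by (simp add: v1_def norm_divide power_divide field_simps power2_eq_square power3_eq_cube)
qed

section \<open>Growth of entire functions\<close>

text \<open>Finite order in terms of the modulus. The bound holds at every point, and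
  \<open>C \<ge> 0\<close> together with the base \<open>1 + norm z\<close> makes it monotone in
  \<open>norm z\<close> and in \<open>k\<close>.\<close>

definition exp_poly_growth :: "(complex \<Rightarrow> complex) \<Rightarrow> bool" where
  "exp_poly_growth f \<longleftrightarrow> (\<exists>C k. C \<ge> 0 \<and> (\<forall>z. norm (f z) \<le> exp (C * (1 + norm z) ^ k)))"

text \<open>The zeros in a disc have only finitely many moduli, which cannot fill an interval. This
  supplies the zero-free circles for \<open>blaschke_reduction\<close>.\<close>

lemma zero_free_radius:
  assumes "f holomorphic_on UNIV" "f a \<noteq> 0"
  obtains R where "r \<le> R" "R \<le> r + 1" "\<And>z. norm z = R \<Longrightarrow> f z \<noteq> 0"
proof -
  have "finite (norm ` {z \<in> cball 0 (r + 1). f z = 0})"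
    using entire_finite_zeros_cball[OF assms] by blast
  moreover have "infinite {r..r + 1}" by simp
  ultimately have "\<not> {r..r + 1} \<subseteq> norm ` {z \<in> cball 0 (r + 1). f z = 0}"
    using finite_subset by blast
  then obtain R where R: "R \<in> {r..r + 1}" "R \<notin> norm ` {z \<in> cball 0 (r + 1). f z = 0}"
    by blast
  show ?thesis
  proof (rule that)
    show "f z \<noteq> 0" if "norm z = R" for z
      using R that by auto
  qed (use R in auto)
qed

text \<open>An entire function has no poles, so its characteristic is the proximity function. Finite
  order bounds that by a power of the radius, and \<open>norm_le_exp_proximity_fun\<close> turns
  this into a pointwise bound.\<close>

lemma growth_order_finite_imp_exp_poly_growth:
  assumes f: "f holomorphic_on UNIV" "f a \<noteq> 0" and fin: "growth_order f < \<infinity>"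
  shows "exp_poly_growth f"
proof -
  have "f analytic_on UNIV"
    using f(1) by (simp add: analytic_on_open)
  then have "\<not> is_pole f z" for z
    using analytic_at_imp_no_pole analytic_on_subset by blast
  then have "pole_count f = (\<lambda>_. 0)"
    by (simp add: pole_count_def fun_eq_iff)
  then have T: "nevanlinna_char f r = proximity_fun f r" for r
    by (simp add: nevanlinna_char_def pole_counting_fun_def)
  obtain K where "growth_order f < ereal K"
    using fin less_PInf_Ex_of_nat by (metis ereal_dense2)
  then have "eventually (\<lambda>r. ereal (ln_plus (proximity_fun f r) / ln r) < ereal K) at_top"
    unfolding growth_order_def T by (rule Limsup_lessD)
  then obtain r0 where r0: "\<And>r. r \<ge> r0 \<Longrightarrow> ln_plus (proximity_fun f r) / ln r < K"
    by (auto simp: eventually_at_top_linorder)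
  define r1 where "r1 = max r0 2"
  define k where "k = nat \<lceil>K\<rceil>"
  have prox: "proximity_fun f r \<le> r ^ k" if "r \<ge> r1" for r
  proof -
    have r: "r \<ge> 2" "r \<ge> r0" using that by (auto simp: r1_def)
    then have "ln r > 0" by simp
    then have "ln_plus (proximity_fun f r) < K * ln r"
      using r0[OF r(2)] by (simp add: field_simps)
    also have "\<dots> \<le> real k * ln r"
      using \<open>ln r > 0\<close> by (intro mult_right_mono) (auto simp: k_def of_nat_ceiling)
    also have "\<dots> = ln (r ^ k)"
      using r by (simp add: ln_realpow)
    finally have "max 1 (proximity_fun f r) < r ^ k"
      unfolding ln_plus_def using r by (subst (asm) ln_less_cancel_iff) auto
    then show ?thesis by simp
  qed
  have "norm (f z) \<le> exp (3 * (r1 + 2) ^ k * (1 + norm z) ^ k)" for z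
  proof -
    \<comment> \<open>The summand \<open>2 * norm z\<close> puts \<open>z\<close> within half the
      radius; the summand \<open>r1\<close> puts \<open>R\<close> into the range of
      \<open>prox\<close>.\<close>
    obtain R where R: "2 * norm z + r1 \<le> R" "R \<le> 2 * norm z + r1 + 1" "\<And>z. norm z = R \<Longrightarrow> f z \<noteq> 0"
      using zero_free_radius[OF f] by blast
    have r1: "r1 \<ge> 2" by (simp add: r1_def)
    have "norm (f z) \<le> exp (3 * proximity_fun f R)"
      using R r1 norm_ge_zero[of z] by (intro norm_le_exp_proximity_fun[OF f _ R(3)]) linarith+
    also have "\<dots> \<le> exp (3 * R ^ k)"
      using prox[of R] R(1) norm_ge_zero[of z] by simp
    also have "\<dots> \<le> exp (3 * ((r1 + 2) * (1 + norm z)) ^ k)"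
    proof -
      have "R \<le> (r1 + 2) * (1 + norm z)"
        using R(2) r1 mult_nonneg_nonneg[of r1 "norm z"] norm_ge_zero[of z] unfolding ring_distribs by linarith
      moreover have "0 \<le> R"
        using R(1) r1 norm_ge_zero[of z] by linarith
      ultimately have "R ^ k \<le> ((r1 + 2) * (1 + norm z)) ^ k"
        by (rule power_mono)
      then show ?thesis by simp
    qed
    finally show ?thesis
      by (simp add: power_mult_distrib mult.assoc)
  qed
  then show ?thesis
    unfolding exp_poly_growth_def by (intro exI[of _ "3 * (r1 + 2) ^ k"] exI[of _ k]) (auto simp: r1_def)
qed

lemma exp_poly_growth_shift:
  fixes f :: "complex \<Rightarrow> complex"
  assumes "exp_poly_growth f"
  shows "exp_poly_growth (\<lambda>z. f (z + a))"
proof -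
  obtain C k where C: "C \<ge> 0" "\<And>z. norm (f z) \<le> exp (C * (1 + norm z) ^ k)"
    using assms by (auto simp: exp_poly_growth_def)
  have "norm (f (z + a)) \<le> exp (C * (1 + norm a) ^ k * (1 + norm z) ^ k)" for z
  proof -
    have "1 + norm (z + a) \<le> (1 + norm a) * (1 + norm z)"
      using norm_triangle_ineq[of z a] mult_nonneg_nonneg[of "norm a" "norm z"]
        norm_ge_zero[of a] norm_ge_zero[of z]
      unfolding ring_distribs by linarith
    then have "C * (1 + norm (z + a)) ^ k \<le> C * ((1 + norm a) * (1 + norm z)) ^ k"
      using C(1) by (intro mult_left_mono power_mono) auto
    then have "exp (C * (1 + norm (z + a)) ^ k) \<le> exp (C * (1 + norm a) ^ k * (1 + norm z) ^ k)"
      by (simp add: power_mult_distrib mult.assoc)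
    with C(2)[of "z + a"] show ?thesis
      by (rule order_trans)
  qed
  then show ?thesis
    unfolding exp_poly_growth_def using C(1)
    by (intro exI[of _ "C * (1 + norm a) ^ k"] exI[of _ k]) auto
qed

lemma exp_poly_growth_diff:
  fixes f g :: "complex \<Rightarrow> complex"
  assumes "exp_poly_growth f" "exp_poly_growth g"
  shows "exp_poly_growth (\<lambda>z. f z - g z)"
proof -
  obtain C k where C: "C \<ge> 0" "\<And>z. norm (f z) \<le> exp (C * (1 + norm z) ^ k)"
    using assms(1) by (auto simp: exp_poly_growth_def)
  obtain D l where D: "D \<ge> 0" "\<And>z. norm (g z) \<le> exp (D * (1 + norm z) ^ l)"
    using assms(2) by (auto simp: exp_poly_growth_def)
  define m where "m = max k l"
  \<comment> \<open>The extra 1 in the constant absorbs the factor 2 of the triangle inequality,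
    since \<open>2 \<le> exp x\<close> for \<open>x \<ge> 1\<close>.\<close>
  have "norm (f z - g z) \<le> exp ((C + D + 1) * (1 + norm z) ^ m)" for z
  proof -
    define x where "x = (1 + norm z) ^ m"
    have x: "x \<ge> 1" "(1 + norm z) ^ k \<le> x" "(1 + norm z) ^ l \<le> x"
      unfolding x_def m_def by (auto intro!: power_increasing one_le_power)
    have "C * (1 + norm z) ^ k \<le> C * x" "D * (1 + norm z) ^ l \<le> D * x"
      using C(1) D(1) x by (auto intro: mult_left_mono)
    moreover have "C * x \<ge> 0" "D * x \<ge> 0"
      using C(1) D(1) x by auto
    ultimately have "C * (1 + norm z) ^ k \<le> C * x + D * x" "D * (1 + norm z) ^ l \<le> C * x + D * x"
      by linarith+
    then have "norm (f z) \<le> exp (C * x + D * x)" "norm (g z) \<le> exp (C * x + D * x)"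
      using C(2)[of z] D(2)[of z] by (meson exp_le_cancel_iff order_trans)+
    then have "norm (f z - g z) \<le> 2 * exp (C * x + D * x)"
      using norm_triangle_ineq4[of "f z" "g z"] by linarith
    also have "\<dots> \<le> exp x * exp (C * x + D * x)"
      using exp_ge_add_one_self[of x] x by (intro mult_right_mono) (linarith, simp)
    finally show ?thesis
      by (simp add: x_def exp_add[symmetric] algebra_simps)
  qed
  then show ?thesis
    unfolding exp_poly_growth_def using C(1) D(1)
    by (intro exI[of _ "C + D + 1"] exI[of _ m]) auto
qed

section \<open>Zero-free functions and quotients of polynomial exponential growth\<close>

lemma borel_caratheodory_half:
  assumes g: "g holomorphic_on UNIV" "g 0 = 0" and A: "\<And>z. norm z < r \<Longrightarrow> Re (g z) < A" and z: "norm z \<le> r / 2" "r > 0"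
  shows "norm (g z) \<le> 2 * A"
proof -
  have A0: "A > 0" using A[of 0] g(2) z by simp
  \<comment> \<open>The map \<open>x / (2 * A - x)\<close> sends the half-plane
    \<open>Re x < A\<close> into the unit disc and fixes 0, so the Schwarz lemma gives
    \<open>norm (g z) / norm (2 * A - g z) \<le> 1 / 2\<close>.\<close>
  define \<phi> where "\<phi> \<zeta> = g (of_real r * \<zeta>) / (2 * of_real A - g (of_real r * \<zeta>))" for \<zeta>
  have in_ball: "norm (of_real r * \<zeta>) < r" if "norm \<zeta> < 1" for \<zeta> :: complex
    using that z by (simp add: norm_mult)
  have less: "norm (g x) < norm (2 * of_real A - g x)" if "norm x < r" for x
  proof -
    have "(norm (2 * of_real A - g x))\<^sup>2 - (norm (g x))\<^sup>2 = 4 * A * (A - Re (g x))"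
      unfolding cmod_power2 by (simp add: power2_eq_square algebra_simps)
    also have "\<dots> > 0" using A[OF that] A0 by simp
    finally show ?thesis by (simp add: power_less_imp_less_base)
  qed
  have "\<phi> holomorphic_on ball 0 1"
  proof -
    have "(\<lambda>\<zeta>. g (of_real r * \<zeta>)) holomorphic_on ball 0 1"
      using holomorphic_on_compose_gen[of "\<lambda>\<zeta>. of_real r * \<zeta>" "ball 0 1" g UNIV] g(1)
      by (auto intro: holomorphic_intros simp: o_def)
    then show ?thesis
      unfolding \<phi>_def using less in_ball
      by (intro holomorphic_intros) (auto, metis in_ball less norm_not_less_zero norm_zero eq_iff_diff_eq_0 )
  qed
  moreover have "\<phi> 0 = 0" by (simp add: \<phi>_def g)
  moreover have "norm (\<phi> \<zeta>) < 1" if "norm \<zeta> < 1" for \<zeta>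
  proof -
    have "norm (2 * of_real A - g (of_real r * \<zeta>)) > 0"
      using less[OF in_ball[OF that]] norm_ge_zero order_le_less_trans by blast
    then show ?thesis
      using less[OF in_ball[OF that]] by (simp add: \<phi>_def norm_divide)
  qed
  moreover have "norm (z / of_real r) < 1"
    using z by (simp add: norm_divide)
  ultimately have "norm (\<phi> (z / of_real r)) \<le> norm (z / of_real r)"
    by (rule Schwarz_Lemma(1))
  also have "\<dots> \<le> 1/2" using z by (simp add: norm_divide)
  finally have "norm (g z) / norm (2 * of_real A - g z) \<le> 1 / 2"
    using z by (simp add: \<phi>_def norm_divide)
  moreover have "norm (2 * of_real A - g z) > 0"
    using less[of z] z norm_ge_zero[of "g z"] by linarith
  ultimately have "2 * norm (g z) \<le> norm (2 * of_real A - g z)"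
    by (simp add: field_simps)
  also have "\<dots> \<le> 2 * A + norm (g z)"
    using norm_triangle_ineq4[of "2 * of_real A" "g z"] A0 by simp
  finally show ?thesis by simp
qed

text \<open>For a logarithm \<open>g\<close> of \<open>u\<close> the growth bounds only
  \<open>Re g\<close> from above. Borel-Caratheodory turns this into a polynomial bound on
  \<open>norm g\<close>, and Liouville's theorem makes \<open>g\<close> a polynomial.\<close>

lemma zero_free_exp_poly_growth:
  assumes u: "u holomorphic_on UNIV" "\<And>z. u z \<noteq> 0" and gr: "exp_poly_growth u"
  obtains p where "\<And>z. u z = exp (poly p z)"
proof -
  obtain C k where C: "C \<ge> 0" "\<And>z. norm (u z) \<le> exp (C * (1 + norm z) ^ k)"
    using gr by (auto simp: exp_poly_growth_def)
  obtain g where g: "g holomorphic_on UNIV" "\<And>z. exp (g z) = u z"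
    using holomorphic_logarithm_exists[of UNIV u 0] u by auto
  have Re_le: "Re (g z) \<le> C * (1 + norm z) ^ k" for z
    using C(2)[of z] by (simp add: g(2)[symmetric])
  define h where "h z = g z - g 0" for z
  have h: "h holomorphic_on UNIV" "h 0 = 0"
    unfolding h_def by (auto intro!: holomorphic_intros g)
  \<comment> \<open>The added 1 yields the strict inequality that
    \<open>borel_caratheodory_half\<close> asks for.\<close>
  define M where "M = norm (g 0) + 1"
  have bound: "norm (h z) \<le> (2 * (C * 3 ^ k + M)) * norm z ^ k" if "1 \<le> norm z" for z
  proof -
    define A where "A = C * (1 + 2 * norm z) ^ k + M"
    have "Re (h x) < A" if "norm x < 2 * norm z" for x
    proof -
      have "C * (1 + norm x) ^ k \<le> C * (1 + 2 * norm z) ^ k"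
        using C(1) that by (intro mult_left_mono power_mono) auto
      then show ?thesis
        using Re_le[of x] abs_Re_le_cmod[of "g 0"] by (simp add: h_def A_def M_def)
    qed
    then have "norm (h z) \<le> 2 * A"
      using that by (intro borel_caratheodory_half[OF h, of "2 * norm z"]) auto
    also have "A \<le> C * (3 * norm z) ^ k + M * norm z ^ k"
    proof -
      have "(1 + 2 * norm z) ^ k \<le> (3 * norm z) ^ k"
        using that by (intro power_mono) auto
      then have "C * (1 + 2 * norm z) ^ k \<le> C * (3 * norm z) ^ k"
        using C(1) by (rule mult_left_mono)
      moreover have "M * 1 \<le> M * norm z ^ k"
        using that by (intro mult_left_mono) (auto simp: M_def)
      ultimately show ?thesis
        unfolding A_def by simp
    qed
    finally show ?thesis
      by (simp add: algebra_simps power_mult_distrib)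
  qed
  define p where "p = [:g 0:] + (\<Sum>i\<le>k. monom ((deriv ^^ i) h 0 / fact i) i)"
  have "g z = poly p z" for z
    using Liouville_polynomial[of h 1 _ k z, OF h(1) bound]
    by (simp add: p_def poly_sum poly_monom h_def[of z] algebra_simps)
  then show ?thesis
    using that g(2) by metis
qed

text \<open>Dividing by \<open>f\<close> fails near its zeros, so \<open>f\<close> is replaced by
  the zero-free \<open>v\<close> with the same modulus on a circle. The maximum principle bounds
  \<open>u * v\<close> from above, and Harnack bounds \<open>v\<close> from below in terms of
  \<open>norm (v 0) \<ge> norm (f 0)\<close>.\<close>

lemma exp_poly_growth_quotient:
  assumes f: "f holomorphic_on UNIV" "f 0 \<noteq> 0" "exp_poly_growth f"
    and u: "u holomorphic_on UNIV" "\<And>z. u z \<noteq> 0" and uf: "exp_poly_growth (\<lambda>z. u z * f z)"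
  shows "exp_poly_growth u"
proof -
  obtain C k where C: "C \<ge> 0" "\<And>z. norm (f z) \<le> exp (C * (1 + norm z) ^ k)"
    using f(3) by (auto simp: exp_poly_growth_def)
  obtain D l where D: "D \<ge> 0" "\<And>z. norm (u z * f z) \<le> exp (D * (1 + norm z) ^ l)"
    using uf by (auto simp: exp_poly_growth_def)
  define E where "E = C + D"
  define m where "m = max k l"
  \<comment> \<open>Chosen so that \<open>exp (- B) \<le> norm (f 0)\<close>; the absolute value
    keeps \<open>B\<close> nonnegative, so that it can be absorbed into the polynomial
    bound.\<close>
  define B where "B = \<bar>ln (norm (f 0))\<bar>"
  have E: "E \<ge> 0" using C D by (simp add: E_def)
  have "norm (u w) \<le> exp (3 * (E * 3 ^ m + B) * (1 + norm w) ^ m)" for w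
  proof -
    obtain R where R: "2 * norm w + 1 \<le> R" "R \<le> 2 * norm w + 1 + 1" "\<And>z. norm z = R \<Longrightarrow> f z \<noteq> 0"
      using zero_free_radius[OF f(1,2)] by blast
    have R0: "R > 0" and wR: "norm w \<le> R / 2" using R(1) norm_ge_zero[of w] by linarith+
    obtain v where v: "v holomorphic_on UNIV"
      "\<And>z. norm z \<le> R \<Longrightarrow> v z \<noteq> 0" "\<And>z. norm z \<le> R \<Longrightarrow> norm (f z) \<le> norm (v z)"
      "\<And>z. norm z = R \<Longrightarrow> norm (v z) = norm (f z)"
      using blaschke_reduction[OF f(1,2) R0 R(3)] by auto
    define L where "L = E * (1 + R) ^ m"
    have L: "C * (1 + R) ^ k \<le> L" "D * (1 + R) ^ l \<le> L"
      unfolding L_def E_def m_def using C(1) D(1) R0 by (auto intro!: mult_mono power_increasing)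
    have vL: "norm (v z) \<le> exp L" if "norm z = R" for z
      unfolding v(4)[OF that] using order_trans[OF C(2)[of z]] L(1) that by simp
    have uvL: "norm (u z * v z) \<le> exp L" if "norm z = R" for z
      using order_trans[OF D(2)[of z]] L(2) that v(4)[OF that] by (simp add: norm_mult)
    have "norm (u w * v w) \<le> exp L"
    proof (rule maximum_modulus_frontier[of "\<lambda>z. u z * v z" "cball 0 R"])
      show "(\<lambda>z. u z * v z) holomorphic_on interior (cball 0 R)"
        by (intro holomorphic_intros holomorphic_on_subset[OF u(1)] holomorphic_on_subset[OF v(1)]) auto
      show "continuous_on (closure (cball 0 R)) (\<lambda>z. u z * v z)"
        by (intro holomorphic_on_imp_continuous_on holomorphic_intros holomorphic_on_subset[OF u(1)]
            holomorphic_on_subset[OF v(1)]) auto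
      show "norm (u z * v z) \<le> exp L" if "z \<in> frontier (cball 0 R)" for z
        using uvL that by auto
    qed (use wR R0 in auto)
    moreover have "norm (v 0) ^ 3 \<le> exp L ^ 2 * norm (v w)"
      by (rule harnack_lower_bound[OF v(1,2) vL _ wR R0]) auto
    ultimately have "norm (u w) * norm (v 0) ^ 3 \<le> norm (u w) * (exp L ^ 2 * norm (v w))"
      by (intro mult_left_mono) auto
    also have "\<dots> = norm (u w * v w) * exp L ^ 2"
      by (simp add: norm_mult)
    also have "\<dots> \<le> exp L * exp L ^ 2"
      using \<open>norm (u w * v w) \<le> exp L\<close> by (rule mult_right_mono) simp
    also have "\<dots> = exp (3 * L)"
      by (simp add: exp_of_nat_mult[symmetric] exp_add[symmetric] power2_eq_square)
    finally have "norm (u w) * norm (v 0) ^ 3 \<le> exp (3 * L)" .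
    moreover have "norm (f 0) ^ 3 \<le> norm (v 0) ^ 3"
      using v(3)[of 0] R0 by (intro power_mono) auto
    then have "norm (u w) * norm (f 0) ^ 3 \<le> norm (u w) * norm (v 0) ^ 3"
      by (rule mult_left_mono) auto
    ultimately have "norm (u w) * norm (f 0) ^ 3 \<le> exp (3 * L)"
      by linarith
    moreover have "exp (- (3 * B)) \<le> norm (f 0) ^ 3"
    proof -
      have "exp (3 * - B) = exp (- B) ^ 3"
        by (metis exp_of_nat_mult of_nat_numeral)
      also have "\<dots> \<le> exp (ln (norm (f 0))) ^ 3"
        by (intro power_mono) (auto simp: B_def)
      finally show ?thesis using f(2) by simp
    qed
    then have "norm (u w) * exp (- (3 * B)) \<le> norm (u w) * norm (f 0) ^ 3"
      by (rule mult_left_mono) auto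
    ultimately have "norm (u w) * exp (- (3 * B)) \<le> exp (3 * L)"
      by linarith
    then have "norm (u w) \<le> exp (3 * L) * exp (3 * B)"
      by (simp add: exp_minus field_simps)
    also have "\<dots> = exp (3 * (L + B))"
      by (simp add: exp_add[symmetric] algebra_simps)
    also have "\<dots> \<le> exp (3 * (E * 3 ^ m + B) * (1 + norm w) ^ m)"
    proof -
      have "1 + R \<le> 3 * (1 + norm w)"
        using R(2) norm_ge_zero[of w] by argo
      then have "L \<le> E * (3 * (1 + norm w)) ^ m"
        unfolding L_def using E R0 by (intro mult_left_mono power_mono) auto
      moreover have "B * 1 \<le> B * (1 + norm w) ^ m"
        by (intro mult_left_mono one_le_power) (auto simp: B_def)
      moreover have "(E * 3 ^ m + B) * (1 + norm w) ^ m = E * (3 * (1 + norm w)) ^ m + B * (1 + norm w) ^ m"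
        by (simp only: power_mult_distrib distrib_right mult.assoc)
      ultimately have "L + B \<le> (E * 3 ^ m + B) * (1 + norm w) ^ m"
        by simp
      then have "3 * (L + B) \<le> 3 * ((E * 3 ^ m + B) * (1 + norm w) ^ m)"
        by (rule mult_left_mono) simp
      then show ?thesis
        by (simp only: exp_le_cancel_iff mult.assoc)
    qed
    finally show ?thesis .
  qed
  then show ?thesis
    unfolding exp_poly_growth_def using E
    by (intro exI[of _ "3 * (E * 3 ^ m + B)"] exI[of _ m]) (auto simp: B_def)
qed

section \<open>Exponentials of polynomials along rays\<close>

lemma coeff_pcompose_shift_top:
  fixes p :: "'a :: comm_ring_1 poly"
  assumes "degree p \<le> n"
  shows "coeff (pcompose p [:a, 1:]) n = coeff p n"
  using assms
proof (induction p arbitrary: n)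
  case (pCons b p)
  show ?case
  proof (cases n)
    case 0
    then have "p = 0" using pCons.prems by (cases "p = 0") auto
    then show ?thesis by (simp add: pcompose_pCons)
  next
    case (Suc n')
    have "degree p \<le> n'" using pCons.prems Suc by (cases "p = 0") auto
    then have "coeff (pcompose p [:a, 1:]) n' = coeff p n'" "coeff (pcompose p [:a, 1:]) (Suc n') = 0"
      using pCons.IH[of n'] pCons.IH[of "Suc n'"] by (auto simp: coeff_eq_0)
    then show ?thesis by (simp add: pcompose_pCons Suc coeff_pCons)
  qed
qed auto

text \<open>This coefficient is where translation first becomes visible; it distinguishes the
  translates of \<open>P\<close> by multiples of \<open>c\<close>.\<close>

lemma coeff_pcompose_shift_second:
  fixes p :: "'a :: comm_ring_1 poly"
  assumes "degree p \<le> Suc n"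
  shows "coeff (pcompose p [:a, 1:]) n = coeff p n + of_nat (Suc n) * a * coeff p (Suc n)"
  using assms
proof (induction p arbitrary: n)
  case (pCons b p)
  have deg: "degree p \<le> n" using pCons.prems by (cases "p = 0") auto
  show ?case
  proof (cases n)
    case 0
    then show ?thesis
      using coeff_pcompose_shift_top[OF deg, of a] by (simp add: pcompose_pCons)
  next
    case (Suc n')
    then have "coeff (pcompose p [:a, 1:]) n' = coeff p n' + of_nat (Suc n') * a * coeff p (Suc n')"
      using pCons.IH[of n'] deg by simp
    then show ?thesis
      using coeff_pcompose_shift_top[OF deg, of a]
      by (simp add: pcompose_pCons Suc coeff_pCons algebra_simps)
  qed
qed auto

section \<open>Limits along rays\<close>

lemma tendsto_poly_ray:
  fixes p :: "complex poly"
  assumes "degree p \<le> n"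
  shows "((\<lambda>t. poly p (of_real t * \<zeta>) / of_real t ^ n) \<longlongrightarrow> coeff p n * \<zeta> ^ n) at_top"
  using assms
proof (induction n arbitrary: p)
  case 0
  then obtain b where "p = [:b:]" by (meson degree_eq_zeroE le_zero_eq)
  then show ?case by simp
next
  case (Suc n)
  obtain b q where p: "p = pCons b q" by (cases p)
  have deg: "degree q \<le> n" using Suc.prems p by (cases "q = 0") auto
  have "((\<lambda>t::real. inverse (t ^ Suc n)) \<longlongrightarrow> 0) at_top"
    by (intro tendsto_inverse_0_at_top filterlim_pow_at_top filterlim_ident) auto
  then have "((\<lambda>t. complex_of_real (inverse (t ^ Suc n))) \<longlongrightarrow> of_real 0) at_top"
    by (rule tendsto_of_real)
  then have "((\<lambda>t. b * complex_of_real (inverse (t ^ Suc n)) + \<zeta> * (poly q (of_real t * \<zeta>) / of_real t ^ n)) 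
      \<longlongrightarrow> b * of_real 0 + \<zeta> * (coeff q n * \<zeta> ^ n)) at_top"
    by (intro tendsto_add tendsto_mult tendsto_const Suc.IH deg)
  moreover have "eventually (\<lambda>t. b * complex_of_real (inverse (t ^ Suc n)) + \<zeta> * (poly q (of_real t * \<zeta>) / of_real t ^ n) 
      = poly p (of_real t * \<zeta>) / of_real t ^ Suc n) at_top"
    using eventually_gt_at_top[of 0] by eventually_elim (simp add: p field_simps)
  ultimately have "((\<lambda>t. poly p (of_real t * \<zeta>) / of_real t ^ Suc n) \<longlongrightarrow> b * of_real 0 + \<zeta> * (coeff q n * \<zeta> ^ n)) at_top"
    by (rule Lim_transform_eventually)
  then show ?case by (simp add: p mult_ac)
qed

lemma exp_poly_ray_tendsto_0:
  fixes p :: "complex poly"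
  assumes "degree p \<le> n" "n > 0" "Re (coeff p n * \<zeta> ^ n) < 0"
  shows "((\<lambda>t. exp (poly p (of_real t * \<zeta>))) \<longlongrightarrow> 0) at_top"
proof -
  have "((\<lambda>t. Re (poly p (of_real t * \<zeta>) / of_real t ^ n)) \<longlongrightarrow> Re (coeff p n * \<zeta> ^ n)) at_top"
    by (intro tendsto_Re tendsto_poly_ray assms(1))
  moreover have "filterlim (\<lambda>t::real. t ^ n) at_top at_top"
    using assms(2) by (intro filterlim_pow_at_top filterlim_ident)
  ultimately have "filterlim (\<lambda>t. Re (poly p (of_real t * \<zeta>) / of_real t ^ n) * t ^ n) at_bot at_top"
    by (rule filterlim_tendsto_neg_mult_at_bot[OF _ assms(3)])
  moreover have "eventually (\<lambda>t. Re (poly p (of_real t * \<zeta>) / of_real t ^ n) * t ^ n = Re (poly p (of_real t * \<zeta>))) at_top"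
    using eventually_gt_at_top[of 0]
  proof eventually_elim
    case (elim t)
    have "poly p (of_real t * \<zeta>) / of_real t ^ n = poly p (of_real t * \<zeta>) / of_real (t ^ n)"
      by simp
    then show ?case
      using elim by (simp only: Re_divide_of_real) simp
  qed
  ultimately have "filterlim (\<lambda>t. Re (poly p (of_real t * \<zeta>))) at_bot at_top"
    by (rule filterlim_mono_eventually[OF _ order_refl order_refl])
  then have "((\<lambda>t. norm (exp (poly p (of_real t * \<zeta>)))) \<longlongrightarrow> 0) at_top"
    unfolding norm_exp_eq_Re by (rule filterlim_compose[OF exp_at_bot])
  then show ?thesis by (rule tendsto_norm_zero_cancel)
qed

text \<open>Multiplying out the last factor gives two expressions of the same kind, with exponents
  \<open>p\<close> and \<open>p + q k\<close>. Hence \<open>p\<close> is generalized in the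
  induction.\<close>

lemma exp_poly_prod_ray_tendsto_0:
  fixes p :: "complex poly" and q :: "nat \<Rightarrow> complex poly"
  assumes n: "n > 0" and p: "degree p \<le> n" "Re (coeff p n * \<zeta> ^ n) < 0"
    and q: "\<And>j. degree (q j) \<le> n" "\<And>j. Re (coeff (q j) n * \<zeta> ^ n) \<le> 0"
  shows "((\<lambda>t. exp (poly p (of_real t * \<zeta>)) * (\<Prod>j<k. 1 + exp (poly (q j) (of_real t * \<zeta>)))) \<longlongrightarrow> 0) at_top"
  using p
proof (induction k arbitrary: p)
  case 0
  then show ?case using exp_poly_ray_tendsto_0[OF _ n] by simp
next
  case (Suc k)
  have "Re (coeff (p + q k) n * \<zeta> ^ n) < 0"
    using Suc.prems(2) q(2)[of k] by (simp add: algebra_simps)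
  moreover have "degree (p + q k) \<le> n"
    using Suc.prems(1) q(1)[of k] by (rule degree_add_le)
  ultimately have "((\<lambda>t. exp (poly p (of_real t * \<zeta>)) * (\<Prod>j<k. 1 + exp (poly (q j) (of_real t * \<zeta>))) +
      exp (poly (p + q k) (of_real t * \<zeta>)) * (\<Prod>j<k. 1 + exp (poly (q j) (of_real t * \<zeta>)))) \<longlongrightarrow> 0 + 0) at_top"
    by (intro tendsto_add Suc.IH Suc.prems)
  then show ?case
    by (simp add: exp_add algebra_simps)
qed

text \<open>Here \<open>exp p\<close> may grow, though only at an order below \<open>n\<close>.
  Every term of the expanded product minus 1 contains some \<open>exp (q j)\<close>, whose decay of
  order \<open>n\<close> prevails.\<close>

lemma exp_poly_prod_minus_1_ray_tendsto_0:
  fixes p :: "complex poly" and q :: "nat \<Rightarrow> complex poly"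
  assumes n: "n > 0" and p: "degree p \<le> n" "coeff p n = 0"
    and q: "\<And>j. degree (q j) \<le> n" "\<And>j. Re (coeff (q j) n * \<zeta> ^ n) < 0"
  shows "((\<lambda>t. exp (poly p (of_real t * \<zeta>)) * ((\<Prod>j<k. 1 + exp (poly (q j) (of_real t * \<zeta>))) - 1)) \<longlongrightarrow> 0) at_top"
proof (induction k)
  case (Suc k)
  have "((\<lambda>t. exp (poly (p + q k) (of_real t * \<zeta>)) * (\<Prod>j<k. 1 + exp (poly (q j) (of_real t * \<zeta>)))) \<longlongrightarrow> 0) at_top"
    using p q by (intro exp_poly_prod_ray_tendsto_0[OF n]) (auto intro: degree_add_le less_imp_le)
  from tendsto_add[OF Suc.IH this] show ?case
    by (simp add: exp_add algebra_simps)
qed auto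

lemma complex_root_exists:
  fixes w :: complex
  assumes "n > 0"
  shows "\<exists>z. z ^ n = w"
  using exists_complex_root[of n w] assms by (metis less_not_refl)

text \<open>With a nonzero real part, either \<open>exp p\<close> or its reciprocal would tend to
  0.\<close>

lemma exp_poly_ray_tendsto_1_imp:
  fixes p :: "complex poly"
  assumes "degree p \<le> n" "n > 0" "((\<lambda>t. exp (poly p (of_real t * \<zeta>))) \<longlongrightarrow> 1) at_top"
  shows "Re (coeff p n * \<zeta> ^ n) = 0"
proof (rule ccontr)
  assume "Re (coeff p n * \<zeta> ^ n) \<noteq> 0"
  then consider "Re (coeff p n * \<zeta> ^ n) < 0" | "Re (coeff (- p) n * \<zeta> ^ n) < 0" by fastforce
  then show False
  proof cases
    case 1
    from exp_poly_ray_tendsto_0[OF assms(1,2) this] assms(3) show False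
      using tendsto_unique[OF trivial_limit_at_top_linorder] by fastforce
  next
    case 2
    have "((\<lambda>t. exp (poly (- p) (of_real t * \<zeta>))) \<longlongrightarrow> inverse 1) at_top"
      using tendsto_inverse[OF assms(3)] by (simp add: exp_minus)
    moreover have "((\<lambda>t. exp (poly (- p) (of_real t * \<zeta>))) \<longlongrightarrow> 0) at_top"
      by (rule exp_poly_ray_tendsto_0[OF _ assms(2) 2]) (use assms(1) in simp)
    ultimately show False
      using tendsto_unique[OF trivial_limit_at_top_linorder] by fastforce
  qed
qed

lemma sum_binomial_signed:
  fixes x :: "'a :: comm_ring_1"
  shows "(\<Sum>k\<le>n. (-1) ^ (n - k) * of_nat (n choose k) * x ^ k) = (x - 1) ^ n"
  using binomial_ring[of x "-1" n] by (simp add: mult_ac)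

section \<open>The exponential identity and the degrees of its exponents\<close>

context
  fixes P R :: "complex poly" and c :: complex and n :: nat and a :: "nat \<Rightarrow> complex"
  assumes c: "c \<noteq> 0" and n: "n \<ge> 1"
  defines "a \<equiv> \<lambda>k. (-1) ^ (n - k) * of_nat (n choose k)"
  assumes identity: "\<And>z. (\<Sum>k\<le>n. a k * exp (- poly P (z + of_nat k * c)) *
            (\<Prod>j<k. 1 + exp (poly R (z + of_nat j * c)))) = 1"
begin

definition shift :: "complex poly \<Rightarrow> nat \<Rightarrow> complex poly" where
  "shift p k = pcompose p [:of_nat k * c, 1:]"

lemma poly_shift: "poly (shift p k) z = poly p (z + of_nat k * c)"
  by (simp add: shift_def poly_pcompose add.commute)

lemma degree_shift: "degree (shift p k) = degree p"
  by (simp add: shift_def degree_pcompose)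

lemma coeff_shift: "degree p \<le> d \<Longrightarrow> coeff (shift p k) d = coeff p d"
  by (simp add: shift_def coeff_pcompose_shift_top)

text \<open>Multiplying by \<open>exp G\<close> lets a chosen term of the identity be normalized.
  The choices used are \<open>G = 0\<close>, \<open>G = P\<close>, and the \<open>G\<close> that
  cancels the leading exponential of the last summand.\<close>

lemma identity_shift:
  "(\<Sum>k\<le>n. a k * exp (poly (G - shift P k) z) * (\<Prod>j<k. 1 + exp (poly (shift R j) z))) = exp (poly G z)"
proof -
  have "exp (poly G z) * (\<Sum>k\<le>n. a k * exp (- poly P (z + of_nat k * c)) *
            (\<Prod>j<k. 1 + exp (poly R (z + of_nat j * c)))) = exp (poly G z)"
    by (simp add: identity)
  then show ?thesis
    unfolding poly_shift poly_diff sum_distrib_left exp_diff exp_minus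
    by (simp add: field_simps)
qed

lemma a_top: "a n = 1" and a_bot: "a 0 \<noteq> 0"
  by (simp_all add: a_def)

text \<open>Otherwise, on a ray where the leading term of \<open>P\<close> is positive, the factors
  \<open>exp (- P)\<close> beat the products, whose growth has lower order. The left side of the
  identity would tend to 0 instead of 1.\<close>

lemma degree_P_le: "degree P \<le> degree R"
proof (rule ccontr)
  assume *: "\<not> degree P \<le> degree R"
  define d where "d = degree P"
  have d: "d > 0" "degree R < d" using * by (auto simp: d_def)
  obtain \<zeta> where \<zeta>: "\<zeta> ^ d = 1 / lead_coeff P"
    using complex_root_exists[OF d(1)] by blast
  have "lead_coeff P \<noteq> 0" using d by (auto simp: d_def)
  then have q: "coeff P d * \<zeta> ^ d = 1" unfolding \<zeta> by (simp add: d_def)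
  have "((\<lambda>t. \<Sum>k\<le>n. a k * (exp (poly (0 - shift P k) (of_real t * \<zeta>)) *
      (\<Prod>j<k. 1 + exp (poly (shift R j) (of_real t * \<zeta>))))) \<longlongrightarrow> (\<Sum>k\<le>n. a k * 0)) at_top"
  proof (intro tendsto_sum tendsto_mult tendsto_const exp_poly_prod_ray_tendsto_0[OF d(1)])
    show "Re (coeff (0 - shift P k) d * \<zeta> ^ d) < 0" for k
      using q by (simp add: coeff_shift d_def)
    show "Re (coeff (shift R j) d * \<zeta> ^ d) \<le> 0" for j
      using d by (simp add: coeff_shift coeff_eq_0)
  qed (use d in \<open>auto simp: degree_shift d_def\<close>)
  then have "((\<lambda>t. exp (poly 0 (of_real t * \<zeta>))) \<longlongrightarrow> (0::complex)) at_top"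
    unfolding mult.assoc[symmetric] identity_shift by simp
  then show False
    by (simp add: tendsto_const_iff)
qed

text \<open>On a ray along which \<open>Re R \<rightarrow> \<infinity>\<close> the \<open>k = n\<close> summand dominates the identity, and after dividing by its
  leading factor \<open>exp(-G)\<close> the right-hand side \<open>exp G\<close> must tend to \<open>1\<close>.\<close>

lemma top_coeff_eq:
  assumes d: "d = degree R" "d > 0"
  shows "coeff P d = of_nat n * coeff R d"
proof -
  define G where "G = shift P n - (\<Sum>j<n. shift R j)"
  define r where "r = coeff R d"
  define w where "w = coeff P d - of_nat n * r"
  have r: "r \<noteq> 0" using d by (auto simp: r_def)
  have dP: "degree P \<le> d" and dR: "degree R \<le> d" using degree_P_le d by simp_all
  have cG: "coeff G d = w"
    by (simp add: G_def w_def r_def coeff_shift[OF dP] coeff_shift[OF dR] coeff_sum)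
  have degG: "degree G \<le> d"
    unfolding G_def using dP dR by (intro degree_diff_le degree_sum_le) (auto simp: degree_shift)
  have *: "Re (w * \<zeta> ^ d) = 0" if \<zeta>: "Re (r * \<zeta> ^ d) > 0" for \<zeta>
  proof -
    \<comment> \<open>The exponent of the \<open>k\<close>-th summand once
      \<open>exp (shift R j)\<close> is pulled out of each factor with \<open>j < k\<close>. The top
      coefficients of \<open>P\<close> cancel, leaving \<open>- (n - k) * r\<close>, and
      \<open>A n = 0\<close>.\<close>
    define A where "A k = shift P n - shift P k - (\<Sum>j\<in>{k..<n}. shift R j)" for k
    have summand: "exp (poly (G - shift P k) z) * (\<Prod>j<k. 1 + exp (poly (shift R j) z)) =
        exp (poly (A k) z) * (\<Prod>j<k. 1 + exp (poly (- shift R j) z))" if "k \<le> n" for k z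
    proof -
      have "(\<Prod>j<k. 1 + exp (poly (shift R j) z)) =
          (\<Prod>j<k. exp (poly (shift R j) z) * (1 + exp (poly (- shift R j) z)))"
        by (intro prod.cong) (auto simp: algebra_simps exp_minus)
      also have "\<dots> = exp (\<Sum>j<k. poly (shift R j) z) * (\<Prod>j<k. 1 + exp (poly (- shift R j) z))"
        by (simp add: prod.distrib exp_sum)
      finally have 1: "(\<Prod>j<k. 1 + exp (poly (shift R j) z)) = \<dots>" .
      have "(\<Sum>j<n. shift R j) = (\<Sum>j<k. shift R j) + (\<Sum>j\<in>{k..<n}. shift R j)"
        using that by (metis lessThan_atLeast0 sum.atLeastLessThan_concat zero_le)
      then have 2: "G - shift P k + (\<Sum>j<k. shift R j) = A k"
        by (simp add: G_def A_def)
      show ?thesis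
        unfolding 1 2[symmetric] by (simp add: exp_add poly_sum)
    qed
    have lim: "((\<lambda>t. exp (poly (A k) (of_real t * \<zeta>)) * (\<Prod>j<k. 1 + exp (poly (- shift R j) (of_real t * \<zeta>)))) 
        \<longlongrightarrow> (if k = n then 1 else 0)) at_top" if "k \<le> n" for k
    proof (cases "k = n")
      case True
      have "((\<lambda>t. \<Prod>j<k. 1 + exp (poly (- shift R j) (of_real t * \<zeta>))) \<longlongrightarrow> (\<Prod>j<k. 1 + 0)) at_top"
        using d(2) dR \<zeta> by (intro tendsto_prod tendsto_add tendsto_const exp_poly_ray_tendsto_0[of _ d])
          (auto simp: degree_shift coeff_shift[OF dR] r_def)
      then show ?thesis using True by (simp add: A_def)
    next
      case False
      have "coeff (A k) d = - of_nat (n - k) * r"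
        by (simp add: A_def r_def coeff_shift[OF dP] coeff_shift[OF dR] coeff_sum)
      then have "Re (coeff (A k) d * \<zeta> ^ d) = - real (n - k) * Re (r * \<zeta> ^ d)"
        by (simp only: mult.assoc) (simp add: algebra_simps)
      also have "\<dots> < 0" using \<zeta> False that by (intro mult_neg_pos) auto
      finally have "Re (coeff (A k) d * \<zeta> ^ d) < 0" .
      moreover have "degree (A k) \<le> d"
        unfolding A_def using dP dR by (intro degree_diff_le degree_sum_le) (auto simp: degree_shift)
      moreover have "Re (coeff (- shift R j) d * \<zeta> ^ d) \<le> 0" for j
        using \<zeta> by (simp add: coeff_shift[OF dR] r_def)
      ultimately show ?thesis
        unfolding if_not_P[OF False] using dR
        by (intro exp_poly_prod_ray_tendsto_0[OF d(2)]) (simp_all only: degree_minus degree_shift)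
    qed
    have "((\<lambda>t. \<Sum>k\<le>n. a k * (exp (poly (A k) (of_real t * \<zeta>)) * (\<Prod>j<k. 1 + exp (poly (- shift R j) (of_real t * \<zeta>))))) 
        \<longlongrightarrow> (\<Sum>k\<le>n. a k * (if k = n then 1 else 0))) at_top"
      by (intro tendsto_sum tendsto_mult tendsto_const lim) auto
    moreover have "(\<Sum>k\<le>n. a k * (exp (poly (A k) z) * (\<Prod>j<k. 1 + exp (poly (- shift R j) z)))) = exp (poly G z)" for z
      by (subst identity_shift[of G z, symmetric], intro sum.cong)
        (auto simp only: summand mult.assoc atMost_iff)
    moreover have "(\<Sum>k\<le>n. a k * (if k = n then 1 else 0)) = 1"
      by (simp add: a_top if_distrib[of "(*) (a _)"] cong: if_cong)
    ultimately have "((\<lambda>t. exp (poly G (of_real t * \<zeta>))) \<longlongrightarrow> 1) at_top"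
      by simp
    from exp_poly_ray_tendsto_1_imp[OF degG d(2) this] show ?thesis
      by (simp add: cG)
  qed
  \<comment> \<open>The two directions make \<open>r * \<zeta> ^ d\<close> equal to 1 and to
    \<open>1 + \<i>\<close>. Together they force both the real and the imaginary part of
    \<open>w / r\<close> to vanish.\<close>
  obtain \<zeta>1 where 1: "\<zeta>1 ^ d = 1 / r" using complex_root_exists[OF d(2)] by blast
  obtain \<zeta>2 where 2: "\<zeta>2 ^ d = (1 + \<i>) / r" using complex_root_exists[OF d(2)] by blast
  have "Re (w / r) = 0" using *[of \<zeta>1] r by (simp add: 1)
  moreover have "Re (w / r * (1 + \<i>)) = 0" using *[of \<zeta>2] r by (simp add: 2)
  moreover have "x = 0" if "Re x = 0" "Re (x * (1 + \<i>)) = 0" for x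
    using that by (simp add: complex_eq_iff)
  ultimately have "w / r = 0" by blast
  then show ?thesis using r by (simp add: w_def r_def)
qed

text \<open>Where \<open>Re R \<rightarrow> -\<infinity>\<close> all the products tend to \<open>1\<close>, and what is left is \<open>\<Delta>\<^sup>n (exp(-P)) / exp(-P)\<close>.\<close>

lemma shifted_sum_tendsto_0:
  assumes d: "d = degree R" "d > 0" and \<zeta>: "Re (coeff P d * \<zeta> ^ d) < 0"
  shows "((\<lambda>t. \<Sum>k\<le>n. a k * exp (poly (P - shift P k) (of_real t * \<zeta>))) \<longlongrightarrow> 0) at_top"
proof -
  have dP: "degree P \<le> d" and dR: "degree R \<le> d" using degree_P_le d by simp_all
  have r: "Re (coeff R d * \<zeta> ^ d) < 0"
  proof -
    have eq: "coeff P d * \<zeta> ^ d = of_nat n * (coeff R d * \<zeta> ^ d)"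
      unfolding top_coeff_eq[OF d] by (rule mult.assoc)
    have "Re (of_nat n * x) = real n * Re x" for x
      by simp
    then have "Re (coeff P d * \<zeta> ^ d) = real n * Re (coeff R d * \<zeta> ^ d)"
      unfolding eq .
    with \<zeta> have neg: "real n * Re (coeff R d * \<zeta> ^ d) < 0" by (simp only:)
    show ?thesis
    proof (rule ccontr)
      assume "\<not> ?thesis"
      then have "0 \<le> real n * Re (coeff R d * \<zeta> ^ d)"
        by (intro mult_nonneg_nonneg) auto
      with neg show False by linarith
    qed
  qed
  \<comment> \<open>This is the identity multiplied by \<open>exp P\<close>, with each product split
    as 1 plus its deviation from 1. On this ray \<open>exp P\<close> and all the deviation terms
    tend to 0.\<close>
  have "((\<lambda>t. exp (poly P (of_real t * \<zeta>)) - (\<Sum>k\<le>n. a k * (exp (poly (P - shift P k) (of_real t * \<zeta>)) *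
      ((\<Prod>j<k. 1 + exp (poly (shift R j) (of_real t * \<zeta>))) - 1)))) \<longlongrightarrow> 0 - (\<Sum>k\<le>n. a k * 0)) at_top"
  proof (intro tendsto_diff tendsto_sum tendsto_mult tendsto_const exp_poly_ray_tendsto_0[OF dP d(2) \<zeta>]
      exp_poly_prod_minus_1_ray_tendsto_0[OF d(2)])
    show "degree (P - shift P k) \<le> d" for k
      using dP by (intro degree_diff_le) (auto simp: degree_shift)
    show "coeff (P - shift P k) d = 0" for k
      by (simp add: coeff_shift[OF dP])
    show "degree (shift R j) \<le> d" "Re (coeff (shift R j) d * \<zeta> ^ d) < 0" for j
      using dR r by (simp_all only: degree_shift coeff_shift[OF dR])
  qed
  moreover have "exp (poly P z) - (\<Sum>k\<le>n. a k * (exp (poly (P - shift P k) z) *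
      ((\<Prod>j<k. 1 + exp (poly (shift R j) z)) - 1))) = (\<Sum>k\<le>n. a k * exp (poly (P - shift P k) z))" for z
    by (subst identity_shift[of P z, symmetric], subst sum_subtractf[symmetric], intro sum.cong)
      (auto simp: algebra_simps)
  ultimately show ?thesis by simp
qed

text \<open>If \<open>deg P \<ge> 2\<close>, the second coefficient makes \<open>exp(P - P(\<cdot> + kc))\<close>, for \<open>k \<le> n\<close>, of pairwise different
  size on such a ray, so that their combination cannot cancel.\<close>

lemma exists_oblique_ray:
  fixes q :: complex
  assumes "q \<noteq> 0" "d \<ge> 2"
  shows "\<exists>\<zeta>. Re (q * \<zeta> ^ d) < 0 \<and> Re (c * q * \<zeta> ^ (d - 1)) \<noteq> 0"
proof -
  obtain \<zeta>1 where 1: "\<zeta>1 ^ d = - 1 / q"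
    using complex_root_exists[of d] assms(2) by force
  show ?thesis
  proof (cases "Re (c * q * \<zeta>1 ^ (d - 1)) = 0")
    case False
    then show ?thesis using 1 assms(1) by (intro exI[of _ \<zeta>1]) simp
  next
    case True
    have nz: "c * q * \<zeta>1 ^ (d - 1) \<noteq> 0"
      using c assms 1 by (auto simp: power_0_left)
    \<comment> \<open>Rotating by this angle turns \<open>q * \<zeta> ^ d\<close> by 45 degrees, so
      its real part stays negative. It turns the other quantity by an angle strictly between 0 and
      \<open>pi\<close>, hence off the imaginary axis.\<close>
    define \<theta> where "\<theta> = pi / (4 * real d)"
    define \<zeta> where "\<zeta> = \<zeta>1 * cis \<theta>"
    have "q * \<zeta> ^ d = - cis (pi / 4)"
    proof -
      have "real d * \<theta> = pi / 4" using assms(2) by (simp add: \<theta>_def)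
      then have "\<zeta> ^ d = - 1 / q * cis (pi / 4)"
        using Complex.DeMoivre[of \<theta> d] by (simp only: \<zeta>_def power_mult_distrib 1)
      then show ?thesis
        using assms(1) by simp
    qed
    then have "Re (q * \<zeta> ^ d) < 0"
      by (simp add: cos_45)
    moreover have "c * q * \<zeta> ^ (d - 1) = c * q * \<zeta>1 ^ (d - 1) * cis (real (d - 1) * \<theta>)"
      by (simp add: \<zeta>_def power_mult_distrib Complex.DeMoivre mult_ac)
    then have "Re (c * q * \<zeta> ^ (d - 1)) = - Im (c * q * \<zeta>1 ^ (d - 1)) * sin (real (d - 1) * \<theta>)"
      using True by (simp only: times_complex.sel cis.sel mult_zero_left diff_0 mult_minus_left)
    moreover have "Im (c * q * \<zeta>1 ^ (d - 1)) \<noteq> 0"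
      using True nz by (auto simp only: complex_eq_iff zero_complex.sel)
    moreover have "sin (real (d - 1) * \<theta>) > 0"
    proof (rule sin_gt_zero)
      show "0 < real (d - 1) * \<theta>" using assms by (simp add: \<theta>_def)
      have "real (d - 1) * \<theta> \<le> real d * \<theta>"
        by (intro mult_right_mono) (auto simp: \<theta>_def)
      also have "\<dots> < pi" using assms by (simp add: \<theta>_def)
      finally show "real (d - 1) * \<theta> < pi" .
    qed
    ultimately show ?thesis by auto
  qed
qed

text \<open>For larger degree the sum \<open>S\<close> would be dominated on an oblique ray by its
  first or its last summand, according to the sign of \<open>s\<close>. Their coefficients
  \<open>a 0\<close> and \<open>a n\<close> are nonzero, which contradicts \<open>S\<close> tending
  to 0.\<close>

lemma degree_R_le_1: "degree R \<le> 1"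
proof (rule ccontr)
  assume *: "\<not> degree R \<le> 1"
  define d where "d = degree R"
  have d: "d \<ge> 2" "d > 0" using * by (auto simp: d_def)
  define q where "q = coeff P d"
  have dP: "degree P \<le> d" using degree_P_le by (simp add: d_def)
  have "coeff R d \<noteq> 0" using d by (auto simp: d_def)
  then have q: "q \<noteq> 0"
    using top_coeff_eq[OF d_def d(2)] n by (simp add: q_def)
  obtain \<zeta> where \<zeta>: "Re (q * \<zeta> ^ d) < 0" "Re (c * q * \<zeta> ^ (d - 1)) \<noteq> 0"
    using exists_oblique_ray[OF q d(1)] by blast
  define s where "s = Re (c * q * \<zeta> ^ (d - 1))"
  define S where "S t = (\<Sum>k\<le>n. a k * exp (poly (P - shift P k) (of_real t * \<zeta>)))" for t
  have S0: "(S \<longlongrightarrow> 0) at_top"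
    unfolding S_def using shifted_sum_tendsto_0[OF d_def d(2)] \<zeta>(1) by (simp add: q_def)
  have coeff: "coeff (shift P k) (d - 1) = coeff P (d - 1) + of_nat d * (of_nat k * c) * q" for k
    using coeff_pcompose_shift_second[of P "d - 1" "of_nat k * c"] dP d by (simp add: shift_def q_def)
  have deg: "degree (shift P k - shift P l) \<le> d - 1" for k l
  proof (rule degree_le, safe)
    fix i assume "d - 1 < i"
    then consider "i = d" | "i > d" using d by linarith
    then show "coeff (shift P k - shift P l) i = 0"
      using dP by cases (auto simp: coeff_shift coeff_eq_0 degree_shift)
  qed
  have lim: "((\<lambda>t. exp (poly (shift P k - shift P l) (of_real t * \<zeta>))) \<longlongrightarrow> 0) at_top"
    if "(real k - real l) * s < 0" for k l
  proof (rule exp_poly_ray_tendsto_0[OF deg])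
    have "coeff (shift P k - shift P l) (d - 1) * \<zeta> ^ (d - 1) = 
        of_real (real d * (real k - real l)) * (c * q * \<zeta> ^ (d - 1))"
      unfolding coeff_diff coeff by (simp add: algebra_simps)
    moreover have "Re (of_real x * y) = x * Re y" for x y
      by simp
    ultimately have "Re (coeff (shift P k - shift P l) (d - 1) * \<zeta> ^ (d - 1)) = real d * ((real k - real l) * s)"
      by (simp only: s_def mult.assoc)
    then show "Re (coeff (shift P k - shift P l) (d - 1) * \<zeta> ^ (d - 1)) < 0"
      using that d by (simp add: mult_less_0_iff)
  qed (use d in auto)
  have shift0: "shift P 0 = P" by (simp add: shift_def)
  consider "s > 0" | "s < 0" using \<zeta>(2) by (fastforce simp: s_def)
  then show False
  proof cases
    case 1
    have "((\<lambda>t. \<Sum>k\<le>n. a k * exp (poly (shift P 0 - shift P k) (of_real t * \<zeta>))) \<longlongrightarrow>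
        (\<Sum>k\<le>n. a k * (if k = 0 then 1 else 0))) at_top"
    proof (intro tendsto_sum tendsto_mult tendsto_const)
      fix k
      show "((\<lambda>t. exp (poly (shift P 0 - shift P k) (of_real t * \<zeta>))) \<longlongrightarrow> (if k = 0 then 1 else 0)) at_top"
        using lim[of 0 k] 1 by (cases "k = 0") auto
    qed
    moreover have "(\<Sum>k\<le>n. a k * (if k = 0 then 1 else 0)) = a 0"
      by (simp add: if_distrib[of "(*) (a _)"] cong: if_cong)
    ultimately have "(S \<longlongrightarrow> a 0) at_top"
      by (simp add: S_def[abs_def] shift0)
    then show False
      using S0 a_bot tendsto_unique[OF trivial_limit_at_top_linorder] by blast
  next
    case 2
    have "((\<lambda>t. \<Sum>k\<le>n. a k * exp (poly (shift P n - shift P k) (of_real t * \<zeta>))) \<longlongrightarrow>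
        (\<Sum>k\<le>n. a k * (if k = n then 1 else 0))) at_top"
    proof (intro tendsto_sum tendsto_mult tendsto_const)
      fix k assume "k \<in> {..n}"
      then show "((\<lambda>t. exp (poly (shift P n - shift P k) (of_real t * \<zeta>))) \<longlongrightarrow> (if k = n then 1 else 0)) at_top"
        using lim[of n k] 2 by (cases "k = n") (auto simp: mult_less_0_iff)
    qed
    moreover have "(\<Sum>k\<le>n. a k * (if k = n then 1 else 0)) = a n"
      by (simp add: if_distrib[of "(*) (a _)"] cong: if_cong)
    \<comment> \<open>Normalizing by the last summand multiplies \<open>S\<close> by a factor that
      itself tends to 0 for \<open>s < 0\<close>, so the product tends both to
      \<open>a n = 1\<close> and to 0.\<close>
    moreover have "(\<Sum>k\<le>n. a k * exp (poly (shift P n - shift P k) (of_real t * \<zeta>))) =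
        exp (poly (shift P n - shift P 0) (of_real t * \<zeta>)) * S t" for t
      unfolding S_def sum_distrib_left
      by (intro sum.cong refl) (simp add: shift0 exp_diff field_simps)
    ultimately have "((\<lambda>t. exp (poly (shift P n - shift P 0) (of_real t * \<zeta>)) * S t) \<longlongrightarrow> a n) at_top"
      by simp
    moreover have "((\<lambda>t. exp (poly (shift P n - shift P 0) (of_real t * \<zeta>)) * S t) \<longlongrightarrow> 0 * 0) at_top"
      using 2 n by (intro tendsto_mult S0 lim) (auto simp: mult_less_0_iff)
    ultimately show False
      using a_top tendsto_unique[OF trivial_limit_at_top_linorder] by fastforce
  qed
qed

text \<open>Now \<open>P\<close> is linear, so \<open>P - shift P k\<close> is constant and the sum
  in \<open>shifted_sum_tendsto_0\<close> does not depend on \<open>t\<close>. It therefore equals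
  0, and by the binomial theorem it is \<open>(exp (- (q * c)) - 1) ^ n\<close>. The result says
  that \<open>exp R\<close> has period \<open>n * c\<close>.\<close>

lemma degree_R_1_imp_periodic:
  assumes "degree R = 1"
  shows "exp (of_nat n * coeff R 1 * c) = 1"
proof -
  define q where "q = coeff P 1"
  have d: "1 = degree R" "(0::nat) < 1" using assms by auto
  have q: "q = of_nat n * coeff R 1"
    using top_coeff_eq[OF d] by (simp add: q_def)
  have "coeff R 1 \<noteq> 0" using assms by (metis leading_coeff_0_iff degree_0 zero_neq_one)
  then have q0: "q \<noteq> 0" using q n by simp
  have "degree P \<le> 1" using degree_P_le d by simp
  then have P: "P = [:coeff P 0, q:]"
    by (intro poly_eqI) (auto simp: coeff_pCons q_def coeff_eq_0 split: nat.split)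
  have "((\<lambda>t. \<Sum>k\<le>n. a k * exp (poly (P - shift P k) (of_real t * (- 1 / q)))) \<longlongrightarrow> 0) at_top"
    by (rule shifted_sum_tendsto_0[OF d]) (use q0 in \<open>simp add: q_def\<close>)
  moreover have "exp (poly (P - shift P k) z) = exp (- (q * c)) ^ k" for k z
    unfolding exp_of_nat_mult[symmetric] by (subst (1 2) P) (simp add: poly_shift algebra_simps)
  ultimately have "(\<Sum>k\<le>n. a k * exp (- (q * c)) ^ k) = 0"
    by (simp add: tendsto_const_iff)
  then have "(exp (- (q * c)) - 1) ^ n = 0"
    using sum_binomial_signed[of n "exp (- (q * c))"] by (simp add: a_def)
  then show ?thesis
    by (simp add: exp_minus q)
qed

end

section \<open>Shared zeros of differences\<close>

lemma entire_translate:
  assumes "f holomorphic_on UNIV"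
  shows "(\<lambda>z. f (z + a)) holomorphic_on UNIV"
  by (rule holomorphic_on_compose_gen[unfolded o_def, OF _ assms]) (auto intro!: holomorphic_intros)

text \<open>At each point \<open>x\<close> the same power \<open>(z - x) ^ k x\<close> splits off
  from \<open>f\<close> and from \<open>g\<close>, and the quotient of the cofactors is holomorphic
  near \<open>x\<close>. These local quotients agree, so they define \<open>u\<close>
  globally.\<close>

lemma same_zeros_quotient:
  assumes f: "f holomorphic_on UNIV" "f a \<noteq> 0" and g: "g holomorphic_on UNIV" "g b \<noteq> 0"
    and zeros: "{z. f z = 0} = {z. g z = 0}" "\<And>z. f z = 0 \<Longrightarrow> zorder f z = zorder g z"
  obtains u where "u holomorphic_on UNIV" "\<And>z. u z \<noteq> 0" "\<And>z. g z = u z * f z"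
proof -
  define k where "k z = (if f z = 0 then nat (zorder f z) else 0)" for z
  have g0: "g z = 0 \<longleftrightarrow> f z = 0" for z using zeros(1) by blast
  have "\<exists>h. h holomorphic_on UNIV \<and> h x \<noteq> 0 \<and> (\<forall>z. f z = (z - x) ^ k x * h z)" for x
  proof (cases "f x = 0")
    case True
    with entire_zero_factor[OF f, of x] show ?thesis unfolding k_def if_P[OF True] by metis
  qed (use f in \<open>auto simp: k_def\<close>)
  then obtain F where F: "\<And>x. F x holomorphic_on UNIV" "\<And>x. F x x \<noteq> 0" "\<And>x z. f z = (z - x) ^ k x * F x z"
    by metis
  have "\<exists>h. h holomorphic_on UNIV \<and> h x \<noteq> 0 \<and> (\<forall>z. g z = (z - x) ^ k x * h z)" for x
  proof (cases "f x = 0")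
    case True
    with entire_zero_factor[OF g, of x] zeros(2)[OF True] show ?thesis
      unfolding k_def if_P[OF True] by metis
  qed (use g g0 in \<open>auto simp: k_def\<close>)
  then obtain G where G: "\<And>x. G x holomorphic_on UNIV" "\<And>x. G x x \<noteq> 0" "\<And>x z. g z = (z - x) ^ k x * G x z"
    by metis
  define u where "u z = G z z / F z z" for z
  have "u field_differentiable at x" for x
  proof -
    define S where "S = {z. F x z \<noteq> 0}"
    have "open S"
      unfolding S_def using holomorphic_on_imp_continuous_on[OF F(1)]
      by (intro open_Collect_neq) auto
    have xS: "x \<in> S" using F(2) by (simp add: S_def)
    \<comment> \<open>On \<open>S\<close> no point other than \<open>x\<close> can be a zero of
      \<open>f\<close>, so at \<open>z \<noteq> x\<close> the exponent \<open>k z\<close> is 0 and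
      the common power cancels.\<close>
    have eq: "G x z / F x z = u z" if "z \<in> S" for z
    proof (cases "z = x")
      case False
      then have nz: "(z - x) ^ k x \<noteq> 0" by simp
      then have "f z \<noteq> 0"
        using that F(3)[of z x] by (auto simp: S_def)
      then have "k z = 0" by (simp add: k_def)
      then have "f z = F z z" "g z = G z z"
        using F(3)[of z z] G(3)[of z z] by simp_all
      then have "F z z = (z - x) ^ k x * F x z" "G z z = (z - x) ^ k x * G x z"
        using F(3)[of z x] G(3)[of z x] by simp_all
      then show ?thesis
        using nz by (simp only: u_def mult_divide_mult_cancel_left[OF nz])
    qed (simp add: u_def)
    have "(\<lambda>z. G x z / F x z) holomorphic_on S"
      by (intro holomorphic_intros holomorphic_on_subset[OF G(1)] holomorphic_on_subset[OF F(1)])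
        (auto simp: S_def)
    then have "u holomorphic_on S"
      by (rule holomorphic_transform) (rule eq)
    then show ?thesis
      using \<open>open S\<close> xS by (rule holomorphic_on_imp_differentiable_at)
  qed
  then have "u holomorphic_on UNIV"
    by (simp add: holomorphic_on_def)
  moreover have "u z \<noteq> 0" for z
    using F(2) G(2) by (simp add: u_def)
  moreover have "g z = u z * f z" for z
    using F(2)[of z] F(3)[of z z] G(3)[of z z] by (simp add: u_def)
  ultimately show ?thesis using that by blast
qed

text \<open>\<open>exp_poly_growth_quotient\<close> works at the origin, so a point \<open>a\<close>
  with \<open>f a \<noteq> 0\<close> is translated there and the resulting polynomial is translated
  back.\<close>

lemma finite_growth_quotient_exp_poly:
  assumes f: "f holomorphic_on UNIV" "f a \<noteq> 0" "exp_poly_growth f" and g: "exp_poly_growth g"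
    and u: "u holomorphic_on UNIV" "\<And>z. u z \<noteq> 0" "\<And>z. g z = u z * f z"
  obtains p where "\<And>z. u z = exp (poly p z)"
proof -
  have "exp_poly_growth (\<lambda>z. u (z + a))"
    using exp_poly_growth_quotient[of "\<lambda>z. f (z + a)" "\<lambda>z. u (z + a)"]
      exp_poly_growth_shift[OF f(3), of a] exp_poly_growth_shift[OF g, of a]
      entire_translate f(1,2) u by simp
  then obtain p where p: "\<And>z. u (z + a) = exp (poly p z)"
    using zero_free_exp_poly_growth[of "\<lambda>z. u (z + a)"] entire_translate[OF u(1)] u(2) by blast
  have "u z = exp (poly (pcompose p [:- a, 1:]) z)" for z
    using p[of "z - a"] by (simp add: poly_pcompose)
  then show ?thesis using that by blast
qed

lemma entire_mult_eq_0:
  assumes f: "f holomorphic_on UNIV" and g: "g holomorphic_on UNIV" "g b \<noteq> 0"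
    and "\<And>z. f z * g z = 0"
  shows "f z = 0"
proof -
  define S where "S = {z. g z \<noteq> 0}"
  have "open S"
    unfolding S_def using holomorphic_on_imp_continuous_on[OF g(1)] by (intro open_Collect_neq) auto
  moreover have "S \<noteq> {}" using g(2) by (auto simp: S_def)
  moreover have "f z = 0" if "z \<in> S" for z
    using that assms(4)[of z] by (auto simp: S_def)
  ultimately show ?thesis
    using analytic_continuation_open[of S UNIV f "\<lambda>_. 0" z] f by (auto simp: connected_UNIV)
qed

section \<open>Iterated differences\<close>

lemma fdiff_pow_expansion:
  "fdiff_pow c n f z = (\<Sum>k\<le>n. (-1) ^ (n - k) * of_nat (n choose k) * f (z + of_nat k * c))"
proof (induction n arbitrary: z)
  case (Suc n)
  define g where "g k = f (z + of_nat k * c)" for k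
  have 1: "fdiff_pow c n f (z + c) = (\<Sum>k\<le>n. (-1) ^ (n - k) * of_nat (n choose k) * g (Suc k))"
    unfolding Suc.IH g_def by (simp add: algebra_simps)
  have "fdiff_pow c n f z = (\<Sum>k\<le>n. (-1) ^ (n - k) * of_nat (n choose k) * g k)"
    unfolding Suc.IH g_def ..
  also have "\<dots> = (\<Sum>k\<le>Suc n. (-1) ^ (n - k) * of_nat (n choose k) * g k)"
    by simp
  also have "\<dots> = (-1) ^ n * g 0 + (\<Sum>k\<le>n. (-1) ^ (n - Suc k) * of_nat (n choose Suc k) * g (Suc k))"
    by (subst sum.atMost_Suc_shift) simp
  also have "(\<Sum>k\<le>n. (-1) ^ (n - Suc k) * of_nat (n choose Suc k) * g (Suc k)) =
      (\<Sum>k\<le>n. - ((-1) ^ (n - k) * of_nat (n choose Suc k) * g (Suc k)))"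
  proof (intro sum.cong refl)
    fix k assume "k \<in> {..n}"
    show "(-1) ^ (n - Suc k) * of_nat (n choose Suc k) * g (Suc k) =
        - ((-1) ^ (n - k) * of_nat (n choose Suc k) * g (Suc k))"
    \<comment> \<open>At \<open>k = n\<close> the subtraction \<open>n - Suc k\<close> truncates,
      but the binomial coefficient is 0.\<close>
    proof (cases "k < n")
      case True
      then have "n - k = Suc (n - Suc k)" by simp
      then show ?thesis by (simp del: binomial_Suc_Suc)
    qed (simp add: binomial_eq_0)
  qed
  finally have 2: "fdiff_pow c n f z = (-1) ^ n * g 0 +
      (\<Sum>k\<le>n. - ((-1) ^ (n - k) * of_nat (n choose Suc k) * g (Suc k)))" .
  have "fdiff_pow c (Suc n) f z = fdiff_pow c n f (z + c) - fdiff_pow c n f z"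
    by (simp add: fdiff_def)
  also have "\<dots> = (-1) ^ Suc n * g 0 + (\<Sum>k\<le>n. (-1) ^ (n - k) * of_nat (Suc n choose Suc k) * g (Suc k))"
    unfolding 1 2 by (simp add: sum_negf sum.distrib[symmetric] algebra_simps)
  also have "\<dots> = (\<Sum>k\<le>Suc n. (-1) ^ (Suc n - k) * of_nat (Suc n choose k) * g k)"
    by (subst sum.atMost_Suc_shift) simp
  finally show ?case by (simp add: g_def)
qed simp

lemma fdiff_pow_holomorphic:
  assumes "f holomorphic_on UNIV"
  shows "fdiff_pow c n f holomorphic_on UNIV"
proof (induction n)
  case (Suc n)
  have "(\<lambda>z. fdiff_pow c n f (z + c)) holomorphic_on UNIV"
    using Suc.IH by (rule entire_translate)
  with Suc.IH show ?case
    by (auto simp: fdiff_def[abs_def] intro!: holomorphic_intros)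
qed (use assms in simp)

lemma fdiff_pow_growth:
  assumes "exp_poly_growth f"
  shows "exp_poly_growth (fdiff_pow c n f)"
proof (induction n)
  case (Suc n)
  have "exp_poly_growth (\<lambda>z. fdiff_pow c n f (z + c) - fdiff_pow c n f z)"
    by (intro exp_poly_growth_diff exp_poly_growth_shift Suc.IH)
  then show ?case by (simp add: fdiff_def[of c "fdiff_pow c n f"])
qed (use assms in simp)

text \<open>Iterating backwards gives \<open>F = H\<^sup>N F(\<cdot> - Ne)\<close>; taking \<open>N\<close> above the order of \<open>F\<close> at \<open>w\<close> is contradictory.\<close>

lemma no_entire_solution_periodic_multiplier:
  fixes H F :: "complex \<Rightarrow> complex"
  assumes F: "F holomorphic_on UNIV" "F b \<noteq> 0" and H: "H holomorphic_on UNIV" "H w = 0"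
    and eq: "\<And>z. F (z + e) = H z * F z" and per: "\<And>z. H (z + e) = H z"
  shows False
proof -
  have per': "H (z - of_nat N * e) = H z" for N z
  proof (induction N)
    case (Suc N)
    then show ?case using per[of "z - of_nat (Suc N) * e"] by (simp add: algebra_simps)
  qed simp
  have pow: "F z = H z ^ N * F (z - of_nat N * e)" for N z
  proof (induction N)
    case (Suc N)
    have "F (z - of_nat N * e) = H z * F (z - of_nat (Suc N) * e)"
      using eq[of "z - of_nat (Suc N) * e"] per'[of z "Suc N"] by (simp add: algebra_simps)
    with Suc.IH show ?case by simp
  qed simp
  obtain g where g: "g holomorphic_on UNIV" "g w \<noteq> 0" "\<And>z. F z = (z - w) ^ nat (zorder F w) * g z"
    using entire_zero_factor[OF F, of w] by blast
  \<comment> \<open>With \<open>N = K + 1\<close> factors of \<open>H\<close>, dividing by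
    \<open>(z - w) ^ K\<close> uses up only \<open>K\<close> of them, each with a finite limit. The
    remaining one forces the cofactor \<open>g\<close> to vanish at \<open>w\<close>.\<close>
  define K where "K = nat (zorder F w)"
  have isCont: "isCont h x" if "h holomorphic_on UNIV" for h :: "complex \<Rightarrow> complex" and x
    using holomorphic_on_imp_continuous_on[OF that] by (simp add: continuous_on_eq_continuous_at)
  have "(H has_field_derivative deriv H w) (at w)"
    using H(1) by (intro holomorphic_derivI[of H UNIV]) auto
  then have "(\<lambda>z. (H z - H w) / (z - w)) \<midarrow>w\<rightarrow> deriv H w"
    by (simp add: has_field_derivative_iff)
  then have lim: "(\<lambda>z. H z / (z - w)) \<midarrow>w\<rightarrow> deriv H w"
    by (simp add: H(2))
  have "(\<lambda>z. F (z - of_nat (Suc K) * e)) holomorphic_on UNIV"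
    using entire_translate[OF F(1), of "- (of_nat (Suc K) * e)"] by simp
  then have "(\<lambda>z. (H z / (z - w)) ^ K * H z * F (z - of_nat (Suc K) * e)) \<midarrow>w\<rightarrow>
      deriv H w ^ K * H w * F (w - of_nat (Suc K) * e)"
    by (intro tendsto_mult tendsto_power lim isContD[OF isCont] H(1))
  moreover have "eventually (\<lambda>z. (H z / (z - w)) ^ K * H z * F (z - of_nat (Suc K) * e) = g z) (at w)"
    unfolding eventually_at_filter
  proof (intro always_eventually allI impI)
    fix z assume "z \<noteq> w"
    then have "(z - w) ^ K \<noteq> 0" by simp
    moreover have "(z - w) ^ K * g z = H z ^ Suc K * F (z - of_nat (Suc K) * e)"
      using g(3)[of z] pow[of z "Suc K"] by (simp only: K_def)
    ultimately show "(H z / (z - w)) ^ K * H z * F (z - of_nat (Suc K) * e) = g z"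
      by (simp add: power_divide divide_simps mult_ac)
  qed
  ultimately have "g \<midarrow>w\<rightarrow> deriv H w ^ K * H w * F (w - of_nat (Suc K) * e)"
    by (rule Lim_transform_eventually)
  moreover have "g \<midarrow>w\<rightarrow> g w"
    using isCont[OF g(1)] by (rule isContD)
  ultimately have "g w = 0"
    using H(2) LIM_unique by fastforce
  with g(2) show False by simp
qed

section \<open>From shared zeros to a multiplicative shift\<close>

lemma share_zero_imp_multiplicative_shift:
  assumes n: "n \<ge> 1" and f: "f holomorphic_on UNIV" "\<not> f constant_on UNIV" "growth_order f < \<infinity>"
    and nz: "\<exists>z. fdiff_pow c n f z \<noteq> 0"
    and share: "share_zero_CM {f, fdiff_pow c n f, fdiff_pow c (n + 1) f}"
  obtains A where "\<And>z. f (z + c) = A * f z"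
proof -
  define F where "F = fdiff_pow c n f"
  define G where "G = fdiff_pow c (n + 1) f"
  have G_eq: "G z = F (z + c) - F z" for z by (simp add: G_def F_def fdiff_def)
  obtain b where b: "F b \<noteq> 0" using nz by (auto simp: F_def)
  have zeros: "{z. f z = 0} = {z. F z = 0}" "{z. F z = 0} = {z. G z = 0}"
    and ords: "\<And>z. f z = 0 \<Longrightarrow> zorder f z = zorder F z" "\<And>z. F z = 0 \<Longrightarrow> zorder F z = zorder G z"
    using share unfolding share_zero_CM_def F_def[symmetric] G_def[symmetric] by blast+
  have fb: "f b \<noteq> 0" and Gb: "G b \<noteq> 0" using b zeros by blast+
  have hol: "F holomorphic_on UNIV" "G holomorphic_on UNIV"
    unfolding F_def G_def using fdiff_pow_holomorphic[OF f(1)] by blast+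
  have gr: "exp_poly_growth f"
    using growth_order_finite_imp_exp_poly_growth[OF f(1) fb f(3)] .
  then have grF: "exp_poly_growth F" "exp_poly_growth G"
    unfolding F_def G_def using fdiff_pow_growth by blast+
  have c: "c \<noteq> 0"
  proof
    assume "c = 0"
    then have "fdiff_pow c n f = (\<lambda>z. 0)"
      using n by (cases n) (auto simp: fdiff_def)
    with b show False by (simp add: F_def)
  qed
  obtain u where u: "u holomorphic_on UNIV" "\<And>z. u z \<noteq> 0" "\<And>z. F z = u z * f z"
    using same_zeros_quotient[OF f(1) fb hol(1) b zeros(1) ords(1)] by blast
  obtain v where v: "v holomorphic_on UNIV" "\<And>z. v z \<noteq> 0" "\<And>z. G z = v z * F z"
    using same_zeros_quotient[OF hol(1) b hol(2) Gb zeros(2) ords(2)] by blast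
  obtain P where P: "\<And>z. u z = exp (poly P z)"
    using finite_growth_quotient_exp_poly[OF f(1) fb gr grF(1) u] by blast
  obtain R where R: "\<And>z. v z = exp (poly R z)"
    using finite_growth_quotient_exp_poly[OF hol(1) b grF v] by blast
  have f_eq: "f z = exp (- poly P z) * F z" for z
    using u(3)[of z] by (simp add: P exp_minus)
  have F_step: "F (z + c) = (1 + exp (poly R z)) * F z" for z
    using v(3)[of z] G_eq[of z] by (simp add: R algebra_simps)
  have F_shift: "F (z + of_nat k * c) = (\<Prod>j<k. 1 + exp (poly R (z + of_nat j * c))) * F z" for z k
  proof (induction k)
    case (Suc k)
    have "F (z + of_nat (Suc k) * c) = F (z + of_nat k * c + c)"
      by (simp add: algebra_simps)
    then show ?case
      using Suc.IH by (simp add: F_step)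
  qed simp
  \<comment> \<open>The \<open>n\<close>-th difference of \<open>exp (- P) * F\<close>, formally
    divided by \<open>F\<close>. Since \<open>F\<close> may have zeros, \<open>W = 1\<close> is
    obtained through the identity theorem in \<open>entire_mult_eq_0\<close>.\<close>
  define W where "W z = (\<Sum>k\<le>n. (-1) ^ (n - k) * of_nat (n choose k) * exp (- poly P (z + of_nat k * c)) *
      (\<Prod>j<k. 1 + exp (poly R (z + of_nat j * c))))" for z
  have "(W z - 1) * F z = 0" for z
  proof -
    have "F z = W z * F z"
      unfolding W_def sum_distrib_right
      by (subst F_def, subst fdiff_pow_expansion, simp only: f_eq F_shift) (simp only: mult_ac)
    then show ?thesis by (simp add: algebra_simps)
  qed
  moreover have "(\<lambda>z. W z - 1) holomorphic_on UNIV"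
    unfolding W_def by (intro holomorphic_intros)
  ultimately have identity: "W z = 1" for z
    using entire_mult_eq_0[of "\<lambda>z. W z - 1" F b z] hol(1) b by simp
  note core = degree_P_le[OF c n identity[unfolded W_def]] degree_R_le_1[OF c n identity[unfolded W_def]]
    degree_R_1_imp_periodic[OF c n identity[unfolded W_def]]
  have "degree R \<noteq> 1"
  proof
    assume deg: "degree R = 1"
    define r where "r = coeff R 1"
    have r: "r \<noteq> 0" using deg by (metis r_def leading_coeff_0_iff degree_0 zero_neq_one)
    have "R = [:coeff R 0, r:]"
      using deg by (intro poly_eqI) (auto simp: coeff_pCons r_def coeff_eq_0 split: nat.split)
    then have Rz: "poly R z = coeff R 0 + r * z" for z
      by (metis poly_pCons poly_0 mult.commute add_0_right mult_zero_right)
    define H where "H z = (\<Prod>j<n. 1 + exp (poly R (z + of_nat j * c)))" for z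
    have "H holomorphic_on UNIV"
      unfolding H_def by (intro holomorphic_intros)
    \<comment> \<open>At this point \<open>R\<close> takes the value \<open>\<i> * pi\<close>, so
      the factor \<open>j = 0\<close> of \<open>H\<close> is 0; it is present since
      \<open>n \<ge> 1\<close>.\<close>
    moreover have "H ((\<i> * pi - coeff R 0) / r) = 0"
    proof -
      have "1 + exp (poly R ((\<i> * pi - coeff R 0) / r + of_nat 0 * c)) = 0"
        using r by (simp add: Rz)
      then show ?thesis
        unfolding H_def using n by (intro prod_zero bexI[of _ 0]) auto
    qed
    moreover have "H (z + of_nat n * c) = H z" for z
    proof -
      have "exp (poly R (z + of_nat n * c + of_nat j * c)) = exp (poly R (z + of_nat j * c))" for j
      proof -
        have "poly R (z + of_nat n * c + of_nat j * c) = poly R (z + of_nat j * c) + of_nat n * coeff R 1 * c"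
          by (simp add: Rz r_def algebra_simps)
        then show ?thesis
          by (simp only: exp_add core(3)[OF deg] mult_1_right)
      qed
      then show ?thesis by (simp add: H_def)
    qed
    moreover have "F (z + of_nat n * c) = H z * F z" for z
      by (simp add: F_shift H_def)
    ultimately show False
      using no_entire_solution_periodic_multiplier[OF hol(1) b] by blast
  qed
  with core(1,2) have "degree R = 0" "degree P = 0" by simp_all
  then obtain p r where pr: "P = [:p:]" "R = [:r:]" by (meson degree_eq_zeroE)
  have "f (z + c) = (1 + exp r) * f z" for z
    by (simp add: f_eq F_step pr)
  then show ?thesis using that by blast
qed

theorem corollary1p2:
  fixes c :: complex and n :: nat and f :: "complex \<Rightarrow> complex"
    and m :: nat and z\<^sub>0 :: complex
  assumes "n \<ge> 1"
    and "f holomorphic_on UNIV"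
    and "\<not> f constant_on UNIV"
    and "growth_order f < \<infinity>"
    and "\<exists>z. fdiff_pow c n f z \<noteq> 0"
    and "share_zero_CM {f, fdiff_pow c n f, fdiff_pow c (n + 1) f}"
    and "m \<ge> 1"
    and "fdiff_pow c m f z\<^sub>0 = f z\<^sub>0"
    and "f z\<^sub>0 \<noteq> 0"
  shows "\<forall>z. fdiff_pow c m f z = f z"
proof -
  obtain A where A: "\<And>z. f (z + c) = A * f z"
    using share_zero_imp_multiplicative_shift[OF assms(1-6)] by blast
  \<comment> \<open>\<open>f\<close> is an eigenfunction of the difference operator with eigenvalue
    \<open>A - 1\<close>, so the equation at the single point \<open>z\<^sub>0\<close> determines
    the \<open>m\<close>-th power of the eigenvalue.\<close>
  have pow: "fdiff_pow c k f z = (A - 1) ^ k * f z" for k z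
  proof (induction k arbitrary: z)
    case (Suc k)
    then show ?case by (simp add: fdiff_def A algebra_simps)
  qed simp
  have "(A - 1) ^ m = 1"
    using assms(8,9) by (simp add: pow)
  then show ?thesis by (simp add: pow)
qed

end
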